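(* Let $X$ be a subshift generated by a primitive and recognizable directive sequence $\boldsymbol\tau = (\tau_n \colon \mathcal A_{n+1}^* \to \mathcal A_n^* )_{n\geq0}$, and assume that $(|\mathcal A_n| : n \geq 0)$ is bounded. Then, for a given real number $\alpha$, the following conditions are equivalent: \begin{enumerate} \item[(1)] $\alpha$ is an additive eigenvalue of $X$; \item[(2)] there exist an integer $n \geq 0$ and a letter-coboundary $c_n \colon \mathcal A_n^* \to \mathbb R$ in $X_{\boldsymbol\tau}^{(n)}$ such that $$\sup\big\{ \| c_n(\tau_{n,m}(u)) - \alpha\, h_m(u) \| : u \in \mathcal L(X_{\boldsymbol\tau}^{(m)}) \big\}$$ converges to $0$ as $m \to \infty$; \item[(3)] there exist $n \geq 0$ and a letter-coboundary $c_n \colon \mathcal A_n^* \to \mathbb R$ in $X_{\boldsymbol\tau}^{(n)}$ such that the monoid morphism $\gamma_n \colon \mathcal A_n^* \to (\mathbb R,+)$ given by $\gamma_n(a) = \{c_n(a) - \alpha\, h_n(a)\}$ for $a \in \mathcal A_n$ satisfies that $$\sup\big\{ |\gamma_n(\tau_{n,m}(u))| : u \in \mathcal L(X_{\boldsymbol\tau}^{(m)}) \big\}$$ converges to $0$ as $m \to \infty$. \end{enumerate}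
   Context: Alphabets are finite sets with at least two elements. $\mathcal A^*$ is the free monoid of finite words over $\mathcal A$ and $|w|$ is the length of $w$. $S$ is the shift map $S((x_k)_k)=(x_{k+1})_k$ on $\mathcal A^{\mathbb Z}$; a subshift is a closed set $X\subseteq\mathcal A^{\mathbb Z}$ with $S(X)=X$; $\mathcal L(X)$ is the set of finite words occurring in points of $X$. A substitution $\tau:\mathcal A^*\to\mathcal B^*$ is a monoid morphism such that $\tau(a)$ is non-empty for every $a\in\mathcal A$ and every $b\in\mathcal B$ occurs in some $\tau(a)$; it acts on $x\in\mathcal A^{\mathbb Z}$ by concatenation, with $\tau(x_0)$ starting at coordinate $0$. A directive sequence $\boldsymbol\tau=(\tau_n)_{n\ge0}$ consists of substitutions $\tau_n:\mathcal A_{n+1}^*\to\mathcal A_n^*$. Put $\tau_{n,m}=\tau_n\circ\cdots\circ\tau_{m-1}$ for $m>n$. $X^{(n)}_{\boldsymbol\tau}$ is the set of $x\in\mathcal A_n^{\mathbb Z}$ such that every finite factor of $x$ occurs in $\tau_{n,m}(a)$ for some $m>n$ and $a\in\mathcal A_m$; $X_{\boldsymbol\tau}=X^{(0)}_{\boldsymbol\tau}$; $\boldsymbol\tau$ generates $X$ if $X=X_{\boldsymbol\tau}$. Heights: $h_n(u)=|\tau_{0,n}(u)|$ for $u\in\mathcal A_n^*$, $n\ge1$, and $h_0(u)=|u|$. $\boldsymbol\tau$ is primitive if for every $n$ there is $m>n$ such that every letter of $\mathcal A_n$ occurs in $\tau_{n,m}(a)$ for every $a\in\mathcal A_m$. It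 is recognizable if, for every $n\ge1$, the sets $S^kB_n(a)$ ($a\in\mathcal A_n$, $0\le k<h_n(a)$) are pairwise disjoint, where $B_n(a)=\{\tau_{0,n}(x):x\in X^{(n)}_{\boldsymbol\tau},\ x_0=a\}$. A return word to a letter $a$ in a subshift $Y\subseteq\mathcal A^{\mathbb Z}$ is a word $w$ such that $wa\in\mathcal L(Y)$ and $wa$ contains exactly two occurrences of $a$, one as a prefix and one as a suffix. A letter-coboundary in $Y$ is a monoid morphism $c:\mathcal A^*\to(\mathbb R,+)$ such that $c(w)=0$ for every $a\in\mathcal A$ and every return word $w$ to $a$ in $Y$. A real number $\alpha$ is an additive (continuous) eigenvalue of $X$ if there is a continuous $g:X\to\mathbb R/\mathbb Z$ with $g(Sx)=g(x)+\alpha \pmod{\mathbb Z}$ for all $x\in X$. For $x\in\mathbb R$, $\|x\|$ is the distance from $x$ to the nearest integer, and $\{x\}$ is the unique element of $[-1/2,1/2)$ such that $x-\{x\}$ is an integer. *)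

theory Defs
  imports "HOL-Analysis.Analysis" "HOL-Library.Sublist"
begin

section \<open>Words, points and subshifts\<close>

text \<open>All alphabets are finite subsets of one ambient type \<open>'a\<close>; words over \<open>A\<close> are the elements
  of \<open>lists A\<close>.\<close>

definition alphabet :: "'a set \<Rightarrow> bool" where
  "alphabet A \<longleftrightarrow> finite A \<and> 2 \<le> card A"

definition shift :: "(int \<Rightarrow> 'a) \<Rightarrow> (int \<Rightarrow> 'a)" where
  "shift x = (\<lambda>k. x (k + 1))"

definition full_shift :: "'a set \<Rightarrow> (int \<Rightarrow> 'a) topology" where
  "full_shift A = product_topology (\<lambda>_. discrete_topology A) UNIV"

definition subshift :: "'a set \<Rightarrow> (int \<Rightarrow> 'a) set \<Rightarrow> bool" where
  "subshift A X \<longleftrightarrow> closedin (full_shift A) X \<and> shift ` X = X"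

text \<open>The interval \<open>[i..j]\<close> is empty for \<open>j < i\<close>, so the empty word is a factor of every point.\<close>

definition factors :: "(int \<Rightarrow> 'a) \<Rightarrow> 'a list set" where
  "factors x = {map x [i..j] | i j. True}"

definition language :: "(int \<Rightarrow> 'a) set \<Rightarrow> 'a list set" where
  "language X = (\<Union>x\<in>X. factors x)"

section \<open>Substitutions and directive sequences\<close>

text \<open>A substitution is a function on words; only its values on \<open>lists A\<close> are relevant.\<close>

definition substitution :: "'a set \<Rightarrow> 'b set \<Rightarrow> ('a list \<Rightarrow> 'b list) \<Rightarrow> bool" where
  "substitution A B \<sigma> \<longleftrightarrow>
     \<sigma> \<in> lists A \<rightarrow> lists B \<and>
     \<sigma> [] = [] \<and> (\<forall>u\<in>lists A. \<forall>v\<in>lists A. \<sigma> (u @ v) = \<sigma> u @ \<sigma> v) \<and>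
     (\<forall>a\<in>A. \<sigma> [a] \<noteq> []) \<and>
     (\<forall>b\<in>B. \<exists>a\<in>A. b \<in> set (\<sigma> [a]))"

text \<open>The action on a point \<open>x\<close>: the right half is read off \<open>\<sigma>(x\<^sub>0 \<dots> x\<^sub>i)\<close>, which has length at
  least \<open>i + 1\<close> and starts at coordinate \<open>0\<close>; the left half is read off
  \<open>\<sigma>(x\<^sub>i \<dots> x\<^sub>-\<^sub>1)\<close>, which has length at least \<open>-i\<close> and ends at coordinate \<open>-1\<close>. This uses
  that \<open>\<sigma>\<close> is non-erasing; see \<open>subst_point_nonneg\<close> and \<open>subst_point_neg\<close> below.\<close>

definition subst_point :: "('a list \<Rightarrow> 'b list) \<Rightarrow> (int \<Rightarrow> 'a) \<Rightarrow> (int \<Rightarrow> 'b)" where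
  "subst_point \<sigma> x = (\<lambda>i.
     if 0 \<le> i then \<sigma> (map x [0..i]) ! nat i
     else (let w = \<sigma> (map x [i..-1]) in w ! nat (int (length w) + i)))"

definition directive_sequence :: "(nat \<Rightarrow> 'a set) \<Rightarrow> (nat \<Rightarrow> 'a list \<Rightarrow> 'a list) \<Rightarrow> bool" where
  "directive_sequence A \<tau> \<longleftrightarrow>
     (\<forall>n. alphabet (A n)) \<and> (\<forall>n. substitution (A (Suc n)) (A n) (\<tau> n))"

text \<open>\<open>subst_comp \<tau> n m = \<tau> n \<circ> \<dots> \<circ> \<tau> (m - 1)\<close> for \<open>n < m\<close>, and the identity for \<open>m \<le> n\<close>.\<close>

definition subst_comp :: "(nat \<Rightarrow> 'a list \<Rightarrow> 'a list) \<Rightarrow> nat \<Rightarrow> nat \<Rightarrow> 'a list \<Rightarrow> 'a list" where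
  "subst_comp \<tau> n m = foldr \<tau> [n..<m]"

definition level_shift ::
    "(nat \<Rightarrow> 'a set) \<Rightarrow> (nat \<Rightarrow> 'a list \<Rightarrow> 'a list) \<Rightarrow> nat \<Rightarrow> (int \<Rightarrow> 'a) set" where
  "level_shift A \<tau> n = {x. (\<forall>k. x k \<in> A n) \<and>
     (\<forall>w\<in>factors x. \<exists>m>n. \<exists>a\<in>A m. sublist w (subst_comp \<tau> n m [a]))}"

definition generates ::
    "(nat \<Rightarrow> 'a set) \<Rightarrow> (nat \<Rightarrow> 'a list \<Rightarrow> 'a list) \<Rightarrow> (int \<Rightarrow> 'a) set \<Rightarrow> bool" where
  "generates A \<tau> X \<longleftrightarrow> X = level_shift A \<tau> 0"

definition height :: "(nat \<Rightarrow> 'a list \<Rightarrow> 'a list) \<Rightarrow> nat \<Rightarrow> 'a list \<Rightarrow> nat" where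
  "height \<tau> n u = length (subst_comp \<tau> 0 n u)"

definition primitive :: "(nat \<Rightarrow> 'a set) \<Rightarrow> (nat \<Rightarrow> 'a list \<Rightarrow> 'a list) \<Rightarrow> bool" where
  "primitive A \<tau> \<longleftrightarrow>
     (\<forall>n. \<exists>m>n. \<forall>b\<in>A n. \<forall>a\<in>A m. b \<in> set (subst_comp \<tau> n m [a]))"

definition base ::
    "(nat \<Rightarrow> 'a set) \<Rightarrow> (nat \<Rightarrow> 'a list \<Rightarrow> 'a list) \<Rightarrow> nat \<Rightarrow> 'a \<Rightarrow> (int \<Rightarrow> 'a) set" where
  "base A \<tau> n a = {subst_point (subst_comp \<tau> 0 n) x | x. x \<in> level_shift A \<tau> n \<and> x 0 = a}"

definition recognizable :: "(nat \<Rightarrow> 'a set) \<Rightarrow> (nat \<Rightarrow> 'a list \<Rightarrow> 'a list) \<Rightarrow> bool" where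
  "recognizable A \<tau> \<longleftrightarrow>
     (\<forall>n\<ge>1. disjoint_family_on (\<lambda>(a, k). (shift ^^ k) ` base A \<tau> n a)
               {(a, k). a \<in> A n \<and> k < height \<tau> n [a]})"

section \<open>Letter-coboundaries\<close>

definition return_word :: "(int \<Rightarrow> 'a) set \<Rightarrow> 'a \<Rightarrow> 'a list \<Rightarrow> bool" where
  "return_word Y a w \<longleftrightarrow>
     w @ [a] \<in> language Y \<and> count_list (w @ [a]) a = 2 \<and>
     prefix [a] (w @ [a]) \<and> suffix [a] (w @ [a])"

definition letter_coboundary ::
    "'a set \<Rightarrow> (int \<Rightarrow> 'a) set \<Rightarrow> ('a list \<Rightarrow> real) \<Rightarrow> bool" where
  "letter_coboundary A Y c \<longleftrightarrow>
     c [] = 0 \<and> (\<forall>u\<in>lists A. \<forall>v\<in>lists A. c (u @ v) = c u + c v) \<and>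
     (\<forall>a\<in>A. \<forall>w. return_word Y a w \<longrightarrow> c w = 0)"

section \<open>The circle group and eigenvalues\<close>

text \<open>\<open>\<real>/\<int>\<close> as a group with the quotient topology.\<close>

quotient_type circle = real / "\<lambda>x y :: real. x - y \<in> \<int>"
  morphisms rep_circle to_circle
proof (intro equivpI reflpI sympI transpI)
  show "x - x \<in> \<int>" for x :: real by simp
  show "y - x \<in> \<int>" if "x - y \<in> \<int>" for x y :: real
    using Ints_minus[OF that] by simp
  show "x - z \<in> \<int>" if "x - y \<in> \<int>" "y - z \<in> \<int>" for x y z :: real
    using Ints_add[OF that] by simp
qed

instantiation circle :: ab_group_add
begin

lift_definition zero_circle :: circle is 0 .

lift_definition plus_circle :: "circle \<Rightarrow> circle \<Rightarrow> circle" is "(+)"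
proof -
  fix a b c d :: real
  assume "a - b \<in> \<int>" "c - d \<in> \<int>"
  from Ints_add[OF this] show "a + c - (b + d) \<in> \<int>" by (simp add: algebra_simps)
qed

lift_definition uminus_circle :: "circle \<Rightarrow> circle" is uminus
proof -
  fix a b :: real
  assume "a - b \<in> \<int>"
  from Ints_minus[OF this] show "- a - - b \<in> \<int>" by simp
qed

lift_definition minus_circle :: "circle \<Rightarrow> circle \<Rightarrow> circle" is "(-)"
proof -
  fix a b c d :: real
  assume "a - b \<in> \<int>" "c - d \<in> \<int>"
  from Ints_diff[OF this] show "a - c - (b - d) \<in> \<int>" by (simp add: algebra_simps)
qed

instance by standard (transfer; simp)+

end

instantiation circle :: topological_space
begin

definition open_circle :: "circle set \<Rightarrow> bool" where
  "open_circle U \<longleftrightarrow> open (to_circle -` U)"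

instance
  by standard (auto simp: open_circle_def vimage_Union)

end

definition additive_eigenvalue :: "'a set \<Rightarrow> (int \<Rightarrow> 'a) set \<Rightarrow> real \<Rightarrow> bool" where
  "additive_eigenvalue A X \<alpha> \<longleftrightarrow>
     (\<exists>g :: (int \<Rightarrow> 'a) \<Rightarrow> circle.
        continuous_map (subtopology (full_shift A) X) euclidean g \<and>
        (\<forall>x\<in>X. g (shift x) = g x + to_circle \<alpha>))"

section \<open>Distance to the integers\<close>

definition int_dist :: "real \<Rightarrow> real" where
  "int_dist x = \<bar>x - of_int (round x)\<bar>"

definition centered_frac :: "real \<Rightarrow> real" where
  "centered_frac x = x - of_int (round x)"

lemma centered_frac_unique:
  "y = centered_frac x \<longleftrightarrow> y \<in> {-1/2..<1/2} \<and> x - y \<in> \<int>"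
proof
  assume "y = centered_frac x"
  then show "y \<in> {-1/2..<1/2} \<and> x - y \<in> \<int>"
    unfolding centered_frac_def round_def atLeastLessThan_iff by (auto; linarith)
next
  assume y: "y \<in> {-1/2..<1/2} \<and> x - y \<in> \<int>"
  then obtain k where k: "x - y = of_int k" by (auto elim: Ints_cases)
  have "round x = k"
    unfolding round_def using y k by (intro floor_unique) (auto; linarith)+
  with k show "y = centered_frac x" by (simp add: centered_frac_def)
qed

section \<open>The action of a substitution on points\<close>

lemma substitution_append:
  assumes "substitution A B \<sigma>" "u \<in> lists A" "v \<in> lists A"
  shows "\<sigma> (u @ v) = \<sigma> u @ \<sigma> v"
  using assms unfolding substitution_def by blast

lemma substitution_length_ge:
  assumes "substitution A B \<sigma>" "u \<in> lists A"
  shows "length u \<le> length (\<sigma> u)"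
  using assms(2)
proof (induction u)
  case (Cons a u)
  have "\<sigma> ([a] @ u) = \<sigma> [a] @ \<sigma> u"
    using Cons.hyps by (intro substitution_append[OF assms(1)]) auto
  moreover have "\<sigma> [a] \<noteq> []"
    using assms(1) Cons.hyps unfolding substitution_def by blast
  ultimately show ?case using Cons.IH by (cases "\<sigma> [a]") auto
qed simp

text \<open>The next two lemmas determine \<open>subst_point \<sigma> x\<close>: it is the concatenation of the words
  \<open>\<sigma>(x\<^sub>k)\<close>, with \<open>\<sigma>(x\<^sub>0)\<close> starting at coordinate \<open>0\<close>.\<close>

lemma subst_point_nonneg:
  assumes \<sigma>: "substitution A B \<sigma>" and x: "\<And>k. x k \<in> A" and k: "0 \<le> k"
    and j: "j < length (\<sigma> [x k])"
  shows "subst_point \<sigma> x (int (length (\<sigma> (map x [0..k - 1]))) + int j) = \<sigma> [x k] ! j"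
proof -
  define P where "P = \<sigma> (map x [0..k - 1])"
  define i where "i = int (length P) + int j"
  have "length (map x [0..k - 1]) \<le> length P"
    unfolding P_def using x by (intro substitution_length_ge[OF \<sigma>]) auto
  with k have ki: "k \<le> i" unfolding i_def by simp
  have "map x [0..i] = map x [0..k - 1] @ [x k] @ map x [k + 1..i]"
    using upto_split3[OF k ki] by simp
  also have "\<sigma> \<dots> = \<sigma> (map x [0..k - 1]) @ \<sigma> ([x k] @ map x [k + 1..i])"
    by (rule substitution_append[OF \<sigma>]) (use x in auto)
  also have "\<sigma> ([x k] @ map x [k + 1..i]) = \<sigma> [x k] @ \<sigma> (map x [k + 1..i])"
    by (rule substitution_append[OF \<sigma>]) (use x in auto)
  finally have "\<sigma> (map x [0..i]) = P @ \<sigma> [x k] @ \<sigma> (map x [k + 1..i])"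
    unfolding P_def .
  moreover have "nat i = length P + j" "0 \<le> i" unfolding i_def by auto
  ultimately have "subst_point \<sigma> x i = \<sigma> [x k] ! j"
    using j by (simp add: subst_point_def nth_append)
  then show ?thesis unfolding i_def P_def .
qed

lemma subst_point_neg:
  assumes \<sigma>: "substitution A B \<sigma>" and x: "\<And>k. x k \<in> A" and k: "k < 0"
    and j: "j < length (\<sigma> [x k])"
  shows "subst_point \<sigma> x (int j - int (length (\<sigma> (map x [k..-1])))) = \<sigma> [x k] ! j"
proof -
  define Q where "Q = \<sigma> (map x [k + 1..-1])"
  define i where "i = int j - int (length (\<sigma> (map x [k..-1])))"
  have "map x [k..-1] = [x k] @ map x [k + 1..-1]"
    using k by (simp add: upto_rec1)
  also have "\<sigma> \<dots> = \<sigma> [x k] @ \<sigma> (map x [k + 1..-1])"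
    by (rule substitution_append[OF \<sigma>]) (use x in auto)
  finally have kQ: "\<sigma> (map x [k..-1]) = \<sigma> [x k] @ Q" unfolding Q_def .
  have "length (map x [k + 1..-1]) \<le> length Q"
    unfolding Q_def using x by (intro substitution_length_ge[OF \<sigma>]) auto
  with k j kQ have ik: "i \<le> k" unfolding i_def by simp
  have "map x [i..-1] = map x [i..k - 1] @ map x [k..-1]"
    using upto_split1[of i k "-1"] ik k by simp
  also have "\<sigma> \<dots> = \<sigma> (map x [i..k - 1]) @ \<sigma> (map x [k..-1])"
    by (rule substitution_append[OF \<sigma>]) (use x in auto)
  finally have w: "\<sigma> (map x [i..-1]) = \<sigma> (map x [i..k - 1]) @ \<sigma> [x k] @ Q"
    unfolding kQ .
  have "nat (int (length (\<sigma> (map x [i..-1]))) + i) = length (\<sigma> (map x [i..k - 1])) + j"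
    using arg_cong[OF w, of length] arg_cong[OF kQ, of length] i_def by simp
  then have "subst_point \<sigma> x i = \<sigma> [x k] ! j"
    using j ik k by (simp add: subst_point_def Let_def w nth_append)
  then show ?thesis unfolding i_def .
qed

end

theory Submission
  imports Defs "HOL-Library.Diagonal_Subsequence" "HOL-Library.Nat_Bijection"
begin

text \<open>
  Let \<open>g\<close> be a continuous eigenfunction. On the base
  \<open>B\<^sub>m(a)\<close> of a tower it is almost constant when \<open>m\<close> is large: all points of \<open>B\<^sub>m(a)\<close> read the same long
  word to the right of the origin, and after a shift by half of its length they agree around the origin,
  while the shift adds the same constant to all values (\<open>base_oscillation\<close>). Consider now the points
  that lie in some base at every level (the \<open>core\<close>). If \<open>g\<close> took more values on them than there are
  letters, two different values would occur in one base of each level, against the preceding remark. So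
  \<open>g\<close> has finitely many values on the core (\<open>finite_core_values\<close>), and by compactness its values on deep
  bases are close to these. At a level whose bases are small compared with the gaps between the values,
  each letter \<open>a\<close> selects one value \<open>\<rho>(a)\<close>. Letters that can follow the same letter select the same
  value, since \<open>g\<close> grows by \<open>\<alpha> h\<^sub>n(a)\<close> from one base to the next; hence \<open>c(a) = \<rho>(follower of a) - \<rho>(a)\<close>
  is well defined. It telescopes along words, so it vanishes on return words, and
  \<open>c(\<tau>\<^sub>n\<^sub>,\<^sub>m(u)) - \<alpha> h\<^sub>m(u)\<close> is modulo one the difference of the errors made by replacing \<open>g\<close> with \<open>\<rho>\<close> at
  the two ends of \<open>u\<close> (\<open>letter_labels\<close>, \<open>coboundary_of_eigenfunction\<close>).

  For the converse, fix a core point \<open>x\<^sub>0\<close>. By recognizability and compactness a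
  window of bounded size around a coordinate of \<open>x\<^sub>0\<close> determines the level-\<open>m\<close> letter there and the position
  inside its image (\<open>window_determines_tower\<close>). If the windows at \<open>k\<close> and at \<open>l\<close> coincide, then \<open>l - k\<close> is
  up to sign the height of a word \<open>u\<close> leading from a letter to itself; a coboundary is zero on \<open>\<tau>\<^sub>n\<^sub>,\<^sub>m(u)\<close>, so
  \<open>\<alpha> (l - k)\<close> is within the level-\<open>m\<close> error of an integer (\<open>return_time_estimate\<close>). Thus
  \<open>S\<^sup>k x\<^sub>0 \<mapsto> \<alpha> k\<close> is uniformly continuous modulo one and extends from the dense orbit to an
  eigenfunction (\<open>eigenvalue_of_coboundary\<close>).

  The real errors \<open>\<gamma>\<^sub>n\<close> are congruent to \<open>c\<^sub>n - \<alpha> h\<^sub>n\<close> modulo one, so their smallness is the stronger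
  condition. Conversely, pull the coboundary back to a level from which on all
  errors modulo one are at most \<open>1/8\<close>. The error of a prefix of a word changes by at most \<open>1/8\<close> with each
  letter, so it cannot jump from a neighbourhood of zero to one of another integer, and its absolute value
  is its distance to the integers (\<open>lifted_error_bound\<close>).

  Points of the circle are handled through real representatives and the pseudometric
  \<open>int_dist (x - y)\<close>.
\<close>

section \<open>Distance to the integers\<close>

lemma int_dist_le: "int_dist x \<le> \<bar>x - of_int k\<bar>"
  unfolding int_dist_def by (rule round_diff_minimal)

lemma int_dist_nonneg [simp]: "0 \<le> int_dist x"
  by (simp add: int_dist_def)

lemma int_dist_le_abs: "int_dist x \<le> \<bar>x\<bar>"
  using int_dist_le[of x 0] by simp

lemma int_dist_triangle: "int_dist (x + y) \<le> int_dist x + int_dist y"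
proof -
  have "int_dist (x + y) \<le> \<bar>x + y - of_int (round x + round y)\<bar>"
    by (rule int_dist_le)
  also have "\<dots> \<le> int_dist x + int_dist y"
    unfolding int_dist_def by simp
  finally show ?thesis .
qed

lemma int_dist_cong:
  assumes "x - y \<in> \<int>"
  shows "int_dist x = int_dist y"
proof -
  have *: "int_dist x \<le> int_dist y" if "x = y + of_int k" for x y k
    using int_dist_le[of x "round y + k"] that by (simp add: int_dist_def)
  obtain k where "x - y = of_int k" using assms by (auto elim: Ints_cases)
  then show ?thesis
    using *[of x y k] *[of y x "- k"] by simp
qed

lemma int_dist_minus: "int_dist (- x) = int_dist x"
proof -
  have *: "int_dist (- x) \<le> int_dist x" for x
    using int_dist_le[of "- x" "- round x"] by (simp add: int_dist_def)
  show ?thesis using *[of x] *[of "- x"] by simp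
qed

lemma int_dist_commute: "int_dist (x - y) = int_dist (y - x)"
  using int_dist_minus[of "x - y"] by simp

lemma int_dist_triangle': "int_dist (x - z) \<le> int_dist (x - y) + int_dist (y - z)"
  using int_dist_triangle[of "x - y" "y - z"] by simp

lemma int_dist_eq_0_iff: "int_dist x = 0 \<longleftrightarrow> x \<in> \<int>"
proof
  assume "int_dist x = 0"
  then have "x = of_int (round x)" by (simp add: int_dist_def)
  then show "x \<in> \<int>" by (metis Ints_of_int)
next
  assume "x \<in> \<int>"
  then have "int_dist x = int_dist 0" by (intro int_dist_cong) simp
  then show "int_dist x = 0" by (simp add: int_dist_def)
qed

lemma Ints_if_int_dist_small:
  assumes "\<And>e. e > 0 \<Longrightarrow> int_dist x \<le> e"
  shows "x \<in> \<int>"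
proof -
  have "int_dist x \<le> 0" by (rule field_le_epsilon) (simp add: assms)
  then show ?thesis using int_dist_nonneg[of x] by (simp add: int_dist_eq_0_iff[symmetric])
qed

lemma int_dist_frac: "int_dist (frac t - s) = int_dist (t - s)" "int_dist (s - frac t) = int_dist (s - t)"
  by (auto intro!: int_dist_cong simp: frac_def)

lemma open_int_dist_less: "open {t. int_dist (t - r) < e}"
proof (rule openI)
  fix t assume "t \<in> {t. int_dist (t - r) < e}"
  then have t: "int_dist (t - r) < e" by simp
  have "ball t (e - int_dist (t - r)) \<subseteq> {t. int_dist (t - r) < e}"
  proof
    fix s assume "s \<in> ball t (e - int_dist (t - r))"
    then have "\<bar>s - t\<bar> < e - int_dist (t - r)" by (simp add: dist_real_def)
    moreover have "int_dist (s - r) \<le> \<bar>s - t\<bar> + int_dist (t - r)"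
      using int_dist_triangle'[of s r t] int_dist_le_abs[of "s - t"] by linarith
    ultimately show "s \<in> {t. int_dist (t - r) < e}" by simp
  qed
  with t show "\<exists>e'>0. ball t e' \<subseteq> {t. int_dist (t - r) < e}"
    by (intro exI[of _ "e - int_dist (t - r)"]) simp
qed

text \<open>Representatives in \<open>[0, 1)\<close> stay in a compact interval, so a Cauchy sequence of the circle has
  a limit by Bolzano--Weierstrass: the limit of a convergent subsequence of representatives.\<close>

lemma Cauchy_mod_1_limit:
  fixes t :: "nat \<Rightarrow> real"
  assumes "\<And>e. e > 0 \<Longrightarrow> \<exists>N. \<forall>m\<ge>N. \<forall>n\<ge>N. int_dist (t m - t n) \<le> e"
  shows "\<exists>L. \<forall>e>0. \<exists>N. \<forall>n\<ge>N. int_dist (t n - L) \<le> e"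
proof -
  have "\<forall>n. frac (t n) \<in> {0..1}" by (simp add: frac_ge_0 less_imp_le[OF frac_lt_1])
  then obtain L r where r: "strict_mono r" and lim: "((\<lambda>n. frac (t n)) \<circ> r) \<longlonglongrightarrow> L"
    using compact_Icc[of 0 "1 :: real", unfolded compact_def] by metis
  show ?thesis
  proof (intro exI[of _ L] allI impI)
    fix e :: real assume e: "e > 0"
    obtain N where N: "\<forall>m\<ge>N. \<forall>n\<ge>N. int_dist (t m - t n) \<le> e / 2"
      using assms[of "e / 2"] e by auto
    obtain K where K: "\<And>k. k \<ge> K \<Longrightarrow> \<bar>frac (t (r k)) - L\<bar> < e / 2"
      using lim e unfolding LIMSEQ_def dist_real_def comp_def by (meson half_gt_zero)
    define k where "k = max K N"
    have "int_dist (t (r k) - L) = int_dist (frac (t (r k)) - L)"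
      by (rule int_dist_cong) (simp add: frac_def)
    also have "\<dots> \<le> e / 2"
      using int_dist_le_abs[of "frac (t (r k)) - L"] K[of k] unfolding k_def by simp
    finally have k: "int_dist (t (r k) - L) \<le> e / 2" .
    have "r k \<ge> N" using seq_suble[OF r, of k] unfolding k_def by simp
    then have "int_dist (t n - L) \<le> e" if "n \<ge> N" for n
      using int_dist_triangle'[of "t n" L "t (r k)"] k N that by fastforce
    then show "\<exists>N. \<forall>n\<ge>N. int_dist (t n - L) \<le> e" by blast
  qed
qed

lemma separated_mod_1:
  assumes "finite S" "S \<subseteq> {0..<1}"
  shows "\<exists>d>0. \<forall>s\<in>S. \<forall>t\<in>S. s \<noteq> t \<longrightarrow> d < int_dist (s - t)"
proof -
  define D where "D = (\<lambda>(s, t). int_dist (s - t)) ` {(s, t) \<in> S \<times> S. s \<noteq> t}"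
  have "finite {(s, t) \<in> S \<times> S. s \<noteq> t}"
    by (rule finite_subset[of _ "S \<times> S"]) (use assms(1) in auto)
  then have D: "finite (insert 1 D)" by (simp add: D_def)
  have "0 < d" if d: "d \<in> insert 1 D" for d
  proof -
    have "0 < int_dist (s - t)" if "s \<in> S" "t \<in> S" "s \<noteq> t" for s t
    proof -
      have "s \<in> {0..<1}" "t \<in> {0..<1}" using assms(2) that by blast+
      then have "\<bar>s - t\<bar> < 1" by auto
      then have "s - t \<notin> \<int>" using Ints_nonzero_abs_less1[of "s - t"] that(3) by auto
      then show ?thesis using int_dist_nonneg[of "s - t"] int_dist_eq_0_iff[of "s - t"] by linarith
    qed
    then show ?thesis using d by (auto simp: D_def)
  qed
  then have pos: "0 < Min (insert 1 D)" using D by (subst Min_gr_iff) auto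
  moreover have "Min (insert 1 D) / 2 < int_dist (s - t)" if "s \<in> S" "t \<in> S" "s \<noteq> t" for s t
  proof -
    have "int_dist (s - t) \<in> D" using that by (force simp: D_def)
    then have "Min (insert 1 D) \<le> int_dist (s - t)" by (intro Min_le[OF D]) simp
    then show ?thesis using pos by linarith
  qed
  ultimately show ?thesis by (intro exI[of _ "Min (insert 1 D) / 2"]) auto
qed

section \<open>Eigenvalues through real representatives of eigenfunctions\<close>

definition agree :: "nat \<Rightarrow> (int \<Rightarrow> 'a) \<Rightarrow> (int \<Rightarrow> 'a) \<Rightarrow> bool" where
  "agree N x y \<longleftrightarrow> (\<forall>i. \<bar>i\<bar> \<le> int N \<longrightarrow> x i = y i)"

lemma agree_refl: "agree N x x"
  by (simp add: agree_def)

lemma agree_sym: "agree N x y \<Longrightarrow> agree N y x"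
  by (auto simp: agree_def)

lemma agree_trans: "agree N x y \<Longrightarrow> agree N y z \<Longrightarrow> agree N x z"
  by (auto simp: agree_def)

lemma agree_mono: "agree N x y \<Longrightarrow> M \<le> N \<Longrightarrow> agree M x y"
  by (auto simp: agree_def)

lemma to_circle_eq_iff: "to_circle x = to_circle y \<longleftrightarrow> x - y \<in> \<int>"
  by (simp add: circle.abs_eq_iff)

lemma to_circle_rep [simp]: "to_circle (rep_circle z) = z"
  by (meson Quotient3_circle Quotient3_abs_rep)

lemma topspace_full_shift [simp]: "topspace (full_shift A) = {x. \<forall>k. x k \<in> A}"
  by (auto simp: full_shift_def PiE_def Pi_def)

lemma openin_full_shift_iff:
  "openin (full_shift A) U \<longleftrightarrow>
     U \<subseteq> {x. \<forall>k. x k \<in> A} \<and>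
     (\<forall>x\<in>U. \<exists>N. \<forall>y. (\<forall>k. y k \<in> A) \<longrightarrow> agree N x y \<longrightarrow> y \<in> U)"
proof
  assume U: "openin (full_shift A) U"
  have "\<exists>N. \<forall>y. (\<forall>k. y k \<in> A) \<longrightarrow> agree N x y \<longrightarrow> y \<in> U" if "x \<in> U" for x
  proof -
    have "\<exists>V. finite {i \<in> UNIV. V i \<noteq> topspace (discrete_topology A)} \<and>
        (\<forall>i\<in>UNIV. openin (discrete_topology A) (V i)) \<and> x \<in> Pi\<^sub>E UNIV V \<and> Pi\<^sub>E UNIV V \<subseteq> U"
      using U that unfolding full_shift_def openin_product_topology_alt by (elim bspec)
    then obtain V where fin: "finite {i. V i \<noteq> A}" and V: "x \<in> Pi\<^sub>E UNIV V" "Pi\<^sub>E UNIV V \<subseteq> U"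
      by auto
    obtain N where N: "\<And>i. V i \<noteq> A \<Longrightarrow> \<bar>i\<bar> \<le> int N"
    proof -
      have fin': "finite ((\<lambda>i. nat \<bar>i\<bar>) ` {i. V i \<noteq> A})" using fin by simp
      have "nat \<bar>i\<bar> \<le> Max ((\<lambda>i. nat \<bar>i\<bar>) ` {i. V i \<noteq> A})" if "V i \<noteq> A" for i
        using that by (intro Max_ge[OF fin']) simp
      then show ?thesis
        by (intro that[of "Max ((\<lambda>i. nat \<bar>i\<bar>) ` {i. V i \<noteq> A})"]) (simp add: nat_le_iff)
    qed
    have "y \<in> U" if "\<forall>k. y k \<in> A" "agree N x y" for y
    proof -
      have "y i \<in> V i" for i
      proof (cases "V i = A")
        case False
        then have "y i = x i" using N \<open>agree N x y\<close> by (simp add: agree_def)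
        then show ?thesis using PiE_mem[OF V(1)] by simp
      qed (use that in simp)
      then have "y \<in> Pi\<^sub>E UNIV V" by (intro PiE_I) auto
      then show ?thesis using V(2) by blast
    qed
    then show ?thesis by blast
  qed
  moreover have "U \<subseteq> {x. \<forall>k. x k \<in> A}"
    using openin_subset[OF U] by simp
  ultimately show "U \<subseteq> {x. \<forall>k. x k \<in> A} \<and>
     (\<forall>x\<in>U. \<exists>N. \<forall>y. (\<forall>k. y k \<in> A) \<longrightarrow> agree N x y \<longrightarrow> y \<in> U)" by blast
next
  assume U: "U \<subseteq> {x. \<forall>k. x k \<in> A} \<and>
     (\<forall>x\<in>U. \<exists>N. \<forall>y. (\<forall>k. y k \<in> A) \<longrightarrow> agree N x y \<longrightarrow> y \<in> U)"
  show "openin (full_shift A) U"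
    unfolding full_shift_def openin_product_topology_alt
  proof
    fix x assume x: "x \<in> U"
    then obtain N where N: "\<And>y. (\<forall>k. y k \<in> A) \<Longrightarrow> agree N x y \<Longrightarrow> y \<in> U" using U by blast
    define V where "V = (\<lambda>i. if \<bar>i\<bar> \<le> int N then {x i} else A)"
    have xA: "x i \<in> A" for i using U x by blast
    have "{i. V i \<noteq> A} \<subseteq> {- int N..int N}" unfolding V_def by (auto split: if_splits)
    then have "finite {i. V i \<noteq> A}" by (rule finite_subset) simp
    moreover have "V i \<subseteq> A" for i using xA by (auto simp: V_def)
    moreover have "x \<in> Pi\<^sub>E UNIV V" using xA by (intro PiE_I) (simp_all add: V_def)
    moreover have "Pi\<^sub>E UNIV V \<subseteq> U"
    proof
      fix y assume "y \<in> Pi\<^sub>E UNIV V"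
      then have y: "y i \<in> V i" for i by (rule PiE_mem) simp
      show "y \<in> U"
      proof (rule N)
        show "\<forall>k. y k \<in> A" using y \<open>\<And>i. V i \<subseteq> A\<close> by blast
        show "agree N x y"
          unfolding agree_def using y by (metis V_def singletonD)
      qed
    qed
    ultimately show "\<exists>V. finite {i \<in> UNIV. V i \<noteq> topspace (discrete_topology A)} \<and>
      (\<forall>i\<in>UNIV. openin (discrete_topology A) (V i)) \<and> x \<in> Pi\<^sub>E UNIV V \<and> Pi\<^sub>E UNIV V \<subseteq> U"
      by (intro exI[of _ V] conjI) simp_all
  qed
qed

text \<open>Composing with representatives turns a circle-valued continuous function into a real function
  that is continuous for the pseudometric \<open>int_dist\<close>; conversely \<open>to_circle\<close> turns such a function
  into a continuous one. All estimates on eigenfunctions can then be made on real numbers.\<close>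

lemma additive_eigenvalue_iff:
  assumes X: "X \<subseteq> {x. \<forall>k. x k \<in> A}"
  shows "additive_eigenvalue A X \<alpha> \<longleftrightarrow>
    (\<exists>g :: (int \<Rightarrow> 'a) \<Rightarrow> real.
       (\<forall>x\<in>X. \<forall>e>0. \<exists>N. \<forall>y\<in>X. agree N x y \<longrightarrow> int_dist (g y - g x) < e) \<and>
       (\<forall>x\<in>X. g (shift x) - (g x + \<alpha>) \<in> \<int>))" (is "_ \<longleftrightarrow> (\<exists>g. ?cont g \<and> ?eq g)")
proof
  assume "additive_eigenvalue A X \<alpha>"
  then obtain g :: "(int \<Rightarrow> 'a) \<Rightarrow> circle"
    where g: "continuous_map (subtopology (full_shift A) X) euclidean g"
      and eq: "\<forall>x\<in>X. g (shift x) = g x + to_circle \<alpha>"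
    unfolding additive_eigenvalue_def by blast
  define h where "h = (\<lambda>x. rep_circle (g x))"
  have h: "to_circle (h x) = g x" for x by (simp add: h_def)
  have "?cont h"
  proof (intro ballI allI impI)
    fix x e assume x: "x \<in> X" and e: "(0 :: real) < e"
    define U where "U = to_circle ` {t. int_dist (t - h x) < e}"
    have U: "to_circle t \<in> U \<longleftrightarrow> int_dist (t - h x) < e" for t
    proof
      assume "to_circle t \<in> U"
      then obtain s where s: "t - s \<in> \<int>" "int_dist (s - h x) < e"
        unfolding U_def by (auto simp: to_circle_eq_iff)
      then show "int_dist (t - h x) < e" using int_dist_cong[of "t - h x" "s - h x"] by simp
    qed (auto simp: U_def)
    then have "to_circle -` U = {t. int_dist (t - h x) < e}" by auto
    then have "open U" by (simp add: open_circle_def open_int_dist_less)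
    with g have "openin (subtopology (full_shift A) X) {y \<in> X. g y \<in> U}"
      unfolding continuous_map_def using X by (auto simp: Int_absorb1)
    then obtain W where W: "openin (full_shift A) W" "{y \<in> X. g y \<in> U} = W \<inter> X"
      unfolding openin_subtopology by blast
    have "g x \<in> U" using U[of "h x"] e by (simp add: h int_dist_def)
    then have "x \<in> W" using x W(2) by blast
    with W(1) obtain N where N: "\<And>y. (\<forall>k. y k \<in> A) \<Longrightarrow> agree N x y \<Longrightarrow> y \<in> W"
      unfolding openin_full_shift_iff by blast
    have "int_dist (h y - h x) < e" if "y \<in> X" "agree N x y" for y
    proof -
      have "y \<in> W" using N that X by blast
      then have "g y \<in> U" using that W(2) by blast
      then show ?thesis using U[of "h y"] by (simp add: h)
    qed
    then show "\<exists>N. \<forall>y\<in>X. agree N x y \<longrightarrow> int_dist (h y - h x) < e" by blast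
  qed
  moreover have "?eq h"
    using eq by (auto simp: to_circle_eq_iff[symmetric] h plus_circle.abs_eq[symmetric])
  ultimately show "\<exists>g. ?cont g \<and> ?eq g" by blast
next
  assume "\<exists>g. ?cont g \<and> ?eq g"
  then obtain h :: "(int \<Rightarrow> 'a) \<Rightarrow> real" where h: "?cont h" "?eq h" by blast
  define g where "g = (\<lambda>x. to_circle (h x))"
  have "openin (subtopology (full_shift A) X) {x \<in> X. g x \<in> U}" if U: "open U" for U
  proof -
    have "\<exists>N. \<forall>y\<in>X. agree N x y \<longrightarrow> g y \<in> U" if x: "x \<in> X" "g x \<in> U" for x
    proof -
      have "open (to_circle -` U)" "h x \<in> to_circle -` U"
        using U x by (auto simp: open_circle_def g_def)
      then obtain e where e: "e > 0" "ball (h x) e \<subseteq> to_circle -` U"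
        by (meson open_contains_ball)
      obtain N where N: "\<And>y. y \<in> X \<Longrightarrow> agree N x y \<Longrightarrow> int_dist (h y - h x) < e"
        using h(1) x(1) e(1) by blast
      have "g y \<in> U" if "y \<in> X" "agree N x y" for y
      proof -
        define s where "s = h y - of_int (round (h y - h x))"
        have "\<bar>s - h x\<bar> < e" using N[OF that] by (simp add: int_dist_def s_def algebra_simps)
        then have "s \<in> ball (h x) e" by (simp add: dist_real_def)
        then have "to_circle s \<in> U" using e(2) by blast
        moreover have "to_circle s = g y" by (simp add: g_def to_circle_eq_iff s_def)
        ultimately show ?thesis by simp
      qed
      then show ?thesis by blast
    qed
    then obtain M where M: "\<And>x y. x \<in> X \<Longrightarrow> g x \<in> U \<Longrightarrow> y \<in> X \<Longrightarrow> agree (M x) x y \<Longrightarrow> g y \<in> U"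
      by metis
    define V where "V = {x \<in> X. g x \<in> U}"
    define W where "W = {z. (\<forall>k. z k \<in> A) \<and> (\<exists>x\<in>V. agree (M x) x z)}"
    have "V = W \<inter> X"
      using X M unfolding V_def W_def by (auto intro: agree_refl)
    moreover have "openin (full_shift A) W"
      unfolding openin_full_shift_iff
    proof (intro conjI ballI)
      show "W \<subseteq> {x. \<forall>k. x k \<in> A}" by (auto simp: W_def)
      fix z assume "z \<in> W"
      then obtain x where x: "x \<in> V" "agree (M x) x z" by (auto simp: W_def)
      then have "y \<in> W" if "\<forall>k. y k \<in> A" "agree (M x) z y" for y
        using that agree_trans[OF x(2)] by (auto simp: W_def)
      then show "\<exists>N. \<forall>y. (\<forall>k. y k \<in> A) \<longrightarrow> agree N z y \<longrightarrow> y \<in> W" by blast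
    qed
    ultimately have "openin (subtopology (full_shift A) X) V"
      unfolding openin_subtopology by blast
    then show ?thesis unfolding V_def .
  qed
  then have "continuous_map (subtopology (full_shift A) X) euclidean g"
    unfolding continuous_map_def using X by (auto simp: Int_absorb1)
  moreover have "\<forall>x\<in>X. g (shift x) = g x + to_circle \<alpha>"
    using h(2) by (auto simp: g_def plus_circle.abs_eq to_circle_eq_iff)
  ultimately show "additive_eigenvalue A X \<alpha>" unfolding additive_eigenvalue_def by blast
qed

section \<open>Compactness\<close>

text \<open>Sequential compactness of \<open>A\<^sup>\<int>\<close>. It is stated for an arbitrary finite set \<open>A\<close> so that several
  sequences of points and parameters can be packed into one and converge along one subsequence.\<close>

lemma pointwise_convergent_subsequence:
  fixes x :: "nat \<Rightarrow> int \<Rightarrow> 'b"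
  assumes A: "finite A" and x: "\<And>n k. x n k \<in> A"
  shows "\<exists>r y. strict_mono (r :: nat \<Rightarrow> nat) \<and> (\<forall>k. y k \<in> A) \<and>
    (\<forall>k. \<forall>\<^sub>F n in sequentially. x (r n) k = y k)"
proof -
  define P where "P = (\<lambda>i (s :: nat \<Rightarrow> nat). \<exists>a. \<forall>n. x (s n) (int_decode i) = a)"
  interpret subseqs P
  proof
    fix i :: nat and s :: "nat \<Rightarrow> nat" assume "strict_mono s"
    have "finite (range (\<lambda>n. x (s n) (int_decode i)))"
      by (rule finite_subset[OF _ A]) (use x in auto)
    then obtain a where "infinite {n. x (s n) (int_decode i) = a}"
      using pigeonhole_infinite[of "UNIV :: nat set" "\<lambda>n. x (s n) (int_decode i)"] by auto
    then obtain r :: "nat \<Rightarrow> nat" where "strict_mono r" "\<forall>n. r n \<in> {n. x (s n) (int_decode i) = a}"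
      using infinite_enumerate by blast
    then show "\<exists>r. strict_mono r \<and> P i (s \<circ> r)"
      unfolding P_def by auto
  qed
  have ev: "\<exists>a. \<forall>\<^sub>F n in sequentially. x (diagseq n) k = a" for k
  proof -
    obtain i where i: "k = int_decode i" by (metis int_encode_inverse)
    have "P i (diagseq \<circ> (+) (Suc i))"
      by (rule diagseq_holds) (auto simp: P_def)
    then obtain a where "\<forall>n. x (diagseq (Suc i + n)) k = a" unfolding P_def i by auto
    then have "\<forall>\<^sub>F n in sequentially. x (diagseq n) k = a"
      unfolding eventually_sequentially by (metis le_add_diff_inverse)
    then show ?thesis by blast
  qed
  then obtain y where y: "\<And>k. \<forall>\<^sub>F n in sequentially. x (diagseq n) k = y k" by metis
  have "y k \<in> A" for k
    using eventually_happens'[OF sequentially_bot y[of k]] x by metis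
  then show ?thesis using y subseq_diagseq by blast
qed

lemma eventually_agree:
  assumes "\<And>k. \<forall>\<^sub>F n in F. x n k = y k"
  shows "\<forall>\<^sub>F n in F. agree N y (x n)"
proof -
  have "\<forall>\<^sub>F n in F. \<forall>k\<in>{- int N..int N}. x n k = y k"
    using assms by (intro eventually_ball_finite) auto
  then show ?thesis by eventually_elim (auto simp: agree_def abs_le_iff)
qed


section \<open>Substitutions acting on points\<close>

abbreviation points :: "'a set \<Rightarrow> (int \<Rightarrow> 'a) set" where
  "points A \<equiv> {x. \<forall>k. x k \<in> A}"

definition word :: "(int \<Rightarrow> 'a) \<Rightarrow> nat \<Rightarrow> 'a list" where
  "word x n = map (\<lambda>k. x (int k)) [0..<n]"

definition left_word :: "(int \<Rightarrow> 'a) \<Rightarrow> nat \<Rightarrow> 'a list" where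
  "left_word x n = map (\<lambda>k. x (int k - int n)) [0..<n]"

lemma funpow_shift: "(shift ^^ n) x = (\<lambda>k. x (k + int n))"
  by (induction n arbitrary: x) (auto simp: shift_def algebra_simps)

lemma length_word [simp]: "length (word x n) = n"
  by (simp add: word_def)

lemma length_left_word [simp]: "length (left_word x n) = n"
  by (simp add: left_word_def)

lemma nth_word [simp]: "j < n \<Longrightarrow> word x n ! j = x (int j)"
  by (simp add: word_def)

lemma nth_left_word [simp]: "j < n \<Longrightarrow> left_word x n ! j = x (int j - int n)"
  by (simp add: left_word_def)

lemma word_0 [simp]: "word x 0 = []"
  by (simp add: word_def)

lemma word_Suc: "word x (Suc n) = word x n @ [x (int n)]"
  by (simp add: word_def)

lemma word_1: "word x (Suc 0) = [x 0]"
  by (simp add: word_Suc)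

lemma word_in_lists: "x \<in> points A \<Longrightarrow> word x n \<in> lists A"
  by (auto simp: word_def)

lemma left_word_in_lists: "x \<in> points A \<Longrightarrow> left_word x n \<in> lists A"
  by (auto simp: left_word_def)

lemma word_add: "word x (m + n) = word x m @ word ((shift ^^ m) x) n"
  by (rule nth_equalityI) (auto simp: nth_append funpow_shift)

lemma left_word_add:
  "left_word x (m + n) = left_word (\<lambda>k. x (k - int n)) m @ left_word x n"
  by (rule nth_equalityI) (auto simp: nth_append algebra_simps)

lemma left_word_shift_add: "left_word ((shift ^^ p) x) (q + p) = left_word x q @ word x p"
  by (rule nth_equalityI) (auto simp: nth_append funpow_shift algebra_simps)

lemma word_eq_upto: "map x [0..i] = word x (nat (i + 1))"
  by (rule nth_equalityI) auto

lemma left_word_eq_upto: "map x [i..-1] = left_word x (nat (- i))"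
  by (rule nth_equalityI) (auto simp: add.commute)

lemma window_eq: "map x [- int N..int N] = left_word x N @ word x (Suc N)"
  by (rule nth_equalityI) (auto simp: nth_append)

lemma window_eq_word:
  "map x [- int N..int N] = word (\<lambda>k. x (k - int N)) (2 * N + 1)"
  by (rule nth_equalityI) auto

lemma substitution_in_lists:
  "substitution A B \<sigma> \<Longrightarrow> u \<in> lists A \<Longrightarrow> \<sigma> u \<in> lists B"
  unfolding substitution_def by blast

lemma substitution_covers: "substitution A B \<sigma> \<Longrightarrow> b \<in> B \<Longrightarrow> \<exists>a\<in>A. b \<in> set (\<sigma> [a])"
  by (simp add: substitution_def)

lemma substitution_sublist:
  assumes \<sigma>: "substitution A B \<sigma>" and v: "v \<in> lists A" and uv: "sublist u v"
  shows "sublist (\<sigma> u) (\<sigma> v)"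
proof -
  obtain p q where pq: "v = p @ u @ q" using uv by (auto simp: sublist_def)
  then have "p \<in> lists A" "u \<in> lists A" "q \<in> lists A" "u @ q \<in> lists A" using v by auto
  then have "\<sigma> v = \<sigma> p @ \<sigma> u @ \<sigma> q"
    unfolding pq by (simp add: substitution_append[OF \<sigma>])
  then show ?thesis by simp
qed

lemma substitution_length_ge_letter:
  assumes \<sigma>: "substitution A B \<sigma>" and u: "u \<in> lists A" and b: "b \<in> set u"
  shows "length (\<sigma> [b]) + length u \<le> length (\<sigma> u) + 1"
proof -
  obtain p q where pq: "u = p @ [b] @ q" using b by (metis append_Cons append_Nil split_list)
  then have *: "p \<in> lists A" "[b] \<in> lists A" "q \<in> lists A" "[b] @ q \<in> lists A" using u by auto
  then have "\<sigma> u = \<sigma> p @ \<sigma> [b] @ \<sigma> q"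
    unfolding pq by (simp only: substitution_append[OF \<sigma>])
  then show ?thesis
    using substitution_length_ge[OF \<sigma> *(1)] substitution_length_ge[OF \<sigma> *(3)] pq by simp
qed

lemma substitution_comp:
  assumes \<sigma>: "substitution A B \<sigma>" and \<tau>: "substitution B C \<tau>"
  shows "substitution A C (\<tau> \<circ> \<sigma>)"
  unfolding substitution_def
proof (intro conjI ballI)
  show "\<tau> \<circ> \<sigma> \<in> lists A \<rightarrow> lists C"
    using substitution_in_lists[OF \<sigma>] substitution_in_lists[OF \<tau>] by simp
  show "(\<tau> \<circ> \<sigma>) [] = []"
    using \<sigma> \<tau> by (simp add: substitution_def)
  show "(\<tau> \<circ> \<sigma>) (u @ v) = (\<tau> \<circ> \<sigma>) u @ (\<tau> \<circ> \<sigma>) v" if "u \<in> lists A" "v \<in> lists A" for u v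
    using that by (simp add: substitution_append[OF \<sigma>] substitution_append[OF \<tau>]
        substitution_in_lists[OF \<sigma>])
  show "(\<tau> \<circ> \<sigma>) [a] \<noteq> []" if "a \<in> A" for a
  proof -
    have "[a] \<in> lists A" using that by simp
    then have "length [a] \<le> length (\<sigma> [a])" "\<sigma> [a] \<in> lists B"
      by (rule substitution_length_ge[OF \<sigma>], rule substitution_in_lists[OF \<sigma>])
    then show ?thesis using substitution_length_ge[OF \<tau> \<open>\<sigma> [a] \<in> lists B\<close>] by auto
  qed
  show "\<exists>a\<in>A. c \<in> set ((\<tau> \<circ> \<sigma>) [a])" if c: "c \<in> C" for c
  proof -
    obtain b where b: "b \<in> B" "c \<in> set (\<tau> [b])"
      using substitution_covers[OF \<tau> c] by blast
    obtain a where a: "a \<in> A" "b \<in> set (\<sigma> [a])"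
      using substitution_covers[OF \<sigma> b(1)] by blast
    have "\<sigma> [a] \<in> lists B" using a by (intro substitution_in_lists[OF \<sigma>]) simp
    moreover have "sublist [b] (\<sigma> [a])"
      using split_list[OF a(2)] by (auto simp: sublist_def)
    ultimately have "sublist (\<tau> [b]) (\<tau> (\<sigma> [a]))"
      by (rule substitution_sublist[OF \<tau>])
    then have "set (\<tau> [b]) \<subseteq> set (\<tau> (\<sigma> [a]))" by (rule set_mono_sublist)
    then show ?thesis using a(1) b(2) by auto
  qed
qed

text \<open>The coordinates of \<open>\<sigma>(x)\<close> can be read off the image of any long enough block of \<open>x\<close>, because
  images of blocks extend each other to the right and to the left.\<close>

lemma subst_point_right:
  assumes \<sigma>: "substitution A B \<sigma>" and x: "x \<in> points A" and j: "j < length (\<sigma> (word x p))"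
  shows "subst_point \<sigma> x (int j) = \<sigma> (word x p) ! j"
proof -
  have *: "\<sigma> (word x (m + n)) ! j = \<sigma> (word x m) ! j" if "j < length (\<sigma> (word x m))" for m n
  proof -
    have "\<sigma> (word x (m + n)) = \<sigma> (word x m) @ \<sigma> (word ((shift ^^ m) x) n)"
      unfolding word_add using x
      by (intro substitution_append[OF \<sigma>] word_in_lists) (auto simp: funpow_shift)
    then show ?thesis using that by (simp add: nth_append)
  qed
  have "Suc j \<le> length (\<sigma> (word x (Suc j)))"
    using substitution_length_ge[OF \<sigma> word_in_lists[OF x, of "Suc j"]] by simp
  then have "\<sigma> (word x (Suc j)) ! j = \<sigma> (word x p) ! j"
    using *[of "Suc j" "p - Suc j"] *[of p "Suc j - p"] j
    by (cases "Suc j \<le> p") auto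
  moreover have "subst_point \<sigma> x (int j) = \<sigma> (word x (Suc j)) ! j"
    by (simp add: subst_point_def word_eq_upto nat_add_distrib)
  ultimately show ?thesis by simp
qed

lemma subst_point_left:
  assumes \<sigma>: "substitution A B \<sigma>" and x: "x \<in> points A"
    and j: "1 \<le> j" "j \<le> length (\<sigma> (left_word x p))"
  shows "subst_point \<sigma> x (- int j) = \<sigma> (left_word x p) ! (length (\<sigma> (left_word x p)) - j)"
proof -
  define f where "f = (\<lambda>n. \<sigma> (left_word x n) ! (length (\<sigma> (left_word x n)) - j))"
  have *: "f (m + n) = f n" if "j \<le> length (\<sigma> (left_word x n))" for m n
  proof -
    have "\<sigma> (left_word x (m + n)) = \<sigma> (left_word (\<lambda>k. x (k - int n)) m) @ \<sigma> (left_word x n)"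
      unfolding left_word_add using x
      by (intro substitution_append[OF \<sigma>] left_word_in_lists) auto
    moreover have "a + length (\<sigma> (left_word x n)) - j = a + (length (\<sigma> (left_word x n)) - j)" for a
      using that by simp
    ultimately show ?thesis by (simp add: f_def nth_append)
  qed
  have "j \<le> length (\<sigma> (left_word x j))"
    using substitution_length_ge[OF \<sigma> left_word_in_lists[OF x, of j]] by simp
  then have "f j = f p"
    using *[of j "p - j"] *[of p "j - p"] j by (cases "j \<le> p") auto
  moreover have "subst_point \<sigma> x (- int j) = f j"
  proof -
    have "nat (int (length (\<sigma> (left_word x j))) - int j) = length (\<sigma> (left_word x j)) - j"
      by simp
    then show ?thesis
      using j(1) by (simp add: subst_point_def Let_def left_word_eq_upto f_def)
  qed
  ultimately show ?thesis by (simp add: f_def)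
qed

lemma word_subst_point:
  assumes "substitution A B \<sigma>" "x \<in> points A"
  shows "word (subst_point \<sigma> x) (length (\<sigma> (word x p))) = \<sigma> (word x p)"
  by (rule nth_equalityI) (auto simp: subst_point_right[OF assms])

lemma left_word_subst_point:
  assumes "substitution A B \<sigma>" "x \<in> points A"
  shows "left_word (subst_point \<sigma> x) (length (\<sigma> (left_word x p))) = \<sigma> (left_word x p)"
proof (rule nth_equalityI)
  fix j assume "j < length (left_word (subst_point \<sigma> x) (length (\<sigma> (left_word x p))))"
  then have j: "j < length (\<sigma> (left_word x p))" by simp
  define i where "i = length (\<sigma> (left_word x p)) - j"
  have i: "1 \<le> i" "i \<le> length (\<sigma> (left_word x p))" "j = length (\<sigma> (left_word x p)) - i"
    using j by (auto simp: i_def)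
  have "int j - int (length (\<sigma> (left_word x p))) = - int i" using i by simp
  then show "left_word (subst_point \<sigma> x) (length (\<sigma> (left_word x p))) ! j = \<sigma> (left_word x p) ! j"
    using j subst_point_left[OF assms i(1,2)] i(3) by simp
qed simp

lemma subst_point_in_points:
  assumes \<sigma>: "substitution A B \<sigma>" and x: "x \<in> points A"
  shows "subst_point \<sigma> x \<in> points B"
proof -
  have "subst_point \<sigma> x k \<in> B" for k
  proof (cases "0 \<le> k")
    case True
    then obtain j where k: "k = int j" by (metis zero_le_imp_eq_int)
    have "j < length (\<sigma> (word x (Suc j)))"
      using substitution_length_ge[OF \<sigma> word_in_lists[OF x, of "Suc j"]] by simp
    moreover from this have "subst_point \<sigma> x k = \<sigma> (word x (Suc j)) ! j"
      unfolding k by (rule subst_point_right[OF \<sigma> x])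
    ultimately show ?thesis
      using substitution_in_lists[OF \<sigma> word_in_lists[OF x, of "Suc j"]]
      by (metis in_lists_conv_set nth_mem)
  next
    case False
    define j where "j = nat (- k)"
    have k: "k = - int j" "1 \<le> j" using False by (auto simp: j_def)
    have j: "j \<le> length (\<sigma> (left_word x j))"
      using substitution_length_ge[OF \<sigma> left_word_in_lists[OF x, of j]] by simp
    then have "subst_point \<sigma> x k = \<sigma> (left_word x j) ! (length (\<sigma> (left_word x j)) - j)"
      unfolding k(1) by (rule subst_point_left[OF \<sigma> x k(2)])
    moreover have "length (\<sigma> (left_word x j)) - j < length (\<sigma> (left_word x j))"
      using j k(2) by simp
    ultimately show ?thesis
      using substitution_in_lists[OF \<sigma> left_word_in_lists[OF x, of j]]
      by (metis in_lists_conv_set nth_mem)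
  qed
  then show ?thesis by simp
qed

lemma subst_point_comp:
  assumes \<sigma>: "substitution A B \<sigma>" and \<tau>: "substitution B C \<tau>" and x: "x \<in> points A"
  shows "subst_point (\<tau> \<circ> \<sigma>) x = subst_point \<tau> (subst_point \<sigma> x)"
proof
  fix k
  note \<tau>\<sigma> = substitution_comp[OF \<sigma> \<tau>]
  note y = subst_point_in_points[OF \<sigma> x]
  show "subst_point (\<tau> \<circ> \<sigma>) x k = subst_point \<tau> (subst_point \<sigma> x) k"
  proof (cases "0 \<le> k")
    case True
    then obtain j where k: "k = int j" by (metis zero_le_imp_eq_int)
    define L where "L = length (\<sigma> (word x (Suc j)))"
    have L: "word (subst_point \<sigma> x) L = \<sigma> (word x (Suc j))"
      unfolding L_def by (rule word_subst_point[OF \<sigma> x])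
    have j: "j < length ((\<tau> \<circ> \<sigma>) (word x (Suc j)))"
      using substitution_length_ge[OF \<tau>\<sigma> word_in_lists[OF x, of "Suc j"]] by simp
    then have "j < length (\<tau> (word (subst_point \<sigma> x) L))" by (simp add: L)
    from subst_point_right[OF \<tau>\<sigma> x j] subst_point_right[OF \<tau> y this] show ?thesis
      unfolding k by (simp only: L comp_def)
  next
    case False
    define j where "j = nat (- k)"
    have k: "k = - int j" "1 \<le> j" using False by (auto simp: j_def)
    define L where "L = length (\<sigma> (left_word x j))"
    have L: "left_word (subst_point \<sigma> x) L = \<sigma> (left_word x j)"
      unfolding L_def by (rule left_word_subst_point[OF \<sigma> x])
    have j: "j \<le> length ((\<tau> \<circ> \<sigma>) (left_word x j))"
      using substitution_length_ge[OF \<tau>\<sigma> left_word_in_lists[OF x, of j]] by simp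
    then have "j \<le> length (\<tau> (left_word (subst_point \<sigma> x) L))" by (simp add: L)
    from subst_point_left[OF \<tau>\<sigma> x k(2) j] subst_point_left[OF \<tau> y k(2) this] show ?thesis
      unfolding k(1) by (simp only: L comp_def)
  qed
qed

lemma subst_point_funpow_shift:
  assumes \<sigma>: "substitution A B \<sigma>" and x: "x \<in> points A"
  shows "subst_point \<sigma> ((shift ^^ p) x) = (shift ^^ length (\<sigma> (word x p))) (subst_point \<sigma> x)"
proof
  fix k
  define L where "L = length (\<sigma> (word x p))"
  have Sx: "(shift ^^ p) x \<in> points A" using x by (simp add: funpow_shift)
  have "subst_point \<sigma> ((shift ^^ p) x) k = subst_point \<sigma> x (k + int L)"
  proof (cases "0 \<le> k")
    case True
    then obtain j where k: "k = int j" by (metis zero_le_imp_eq_int)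
    have j: "j < length (\<sigma> (word ((shift ^^ p) x) (Suc j)))"
      using substitution_length_ge[OF \<sigma> word_in_lists[OF Sx, of "Suc j"]] by simp
    have split: "\<sigma> (word x (p + Suc j)) = \<sigma> (word x p) @ \<sigma> (word ((shift ^^ p) x) (Suc j))"
      unfolding word_add by (intro substitution_append[OF \<sigma>] word_in_lists x Sx)
    have "subst_point \<sigma> x (int (j + L)) = \<sigma> (word x (p + Suc j)) ! (j + L)"
      by (rule subst_point_right[OF \<sigma> x], unfold split) (use j in \<open>simp add: L_def\<close>)
    also have "\<dots> = \<sigma> (word ((shift ^^ p) x) (Suc j)) ! j"
      unfolding split by (simp add: nth_append L_def)
    finally show ?thesis
      unfolding k using subst_point_right[OF \<sigma> Sx j] by simp
  next
    case False
    define j where "j = nat (- k)"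
    have k: "k = - int j" "1 \<le> j" using False by (auto simp: j_def)
    define Q where "Q = length (\<sigma> (left_word x j))"
    have Q: "j \<le> Q"
      unfolding Q_def using substitution_length_ge[OF \<sigma> left_word_in_lists[OF x, of j]] by simp
    have split: "\<sigma> (left_word ((shift ^^ p) x) (j + p)) = \<sigma> (left_word x j) @ \<sigma> (word x p)"
      unfolding left_word_shift_add
      by (intro substitution_append[OF \<sigma>] left_word_in_lists word_in_lists x)
    have "subst_point \<sigma> ((shift ^^ p) x) k = \<sigma> (left_word ((shift ^^ p) x) (j + p)) ! (Q + L - j)"
      unfolding k using subst_point_left[OF \<sigma> Sx k(2), of "j + p"] Q
      by (simp add: split Q_def L_def)
    also have "\<dots> = subst_point \<sigma> x (int L - int j)"
    proof (cases "j \<le> L")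
      case True
      then have "subst_point \<sigma> x (int (L - j)) = \<sigma> (word x p) ! (L - j)"
        using k(2) by (intro subst_point_right[OF \<sigma> x]) (simp add: L_def)
      moreover have "(\<sigma> (left_word x j) @ \<sigma> (word x p)) ! (Q + L - j) = \<sigma> (word x p) ! (L - j)"
        using nth_append_length_plus[of "\<sigma> (left_word x j)" "\<sigma> (word x p)" "L - j"] True
        by (simp add: Q_def)
      ultimately show ?thesis
        unfolding split using True by (simp add: of_nat_diff)
    next
      case False
      then have "subst_point \<sigma> x (- int (j - L)) = \<sigma> (left_word x j) ! (Q - (j - L))"
        unfolding Q_def using Q by (intro subst_point_left[OF \<sigma> x]) (auto simp: Q_def)
      moreover have "(\<sigma> (left_word x j) @ \<sigma> (word x p)) ! (Q + L - j) = \<sigma> (left_word x j) ! (Q - (j - L))"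
      proof -
        have "Q + L - j < Q" "Q + L - j = Q - (j - L)" using False Q by auto
        then show ?thesis by (simp only: nth_append Q_def[symmetric] if_True)
      qed
      moreover have "int L - int j = - int (j - L)" using False by simp
      ultimately show ?thesis
        unfolding split by (simp only:)
    qed
    finally show ?thesis unfolding k by (simp add: algebra_simps)
  qed
  then show "subst_point \<sigma> ((shift ^^ p) x) k = (shift ^^ length (\<sigma> (word x p))) (subst_point \<sigma> x) k"
    by (simp add: funpow_shift L_def)
qed

text \<open>A coordinate of \<open>\<sigma>(x)\<close> depends on finitely many coordinates of \<open>x\<close>.\<close>

lemma eventually_subst_point:
  assumes "\<And>k. \<forall>\<^sub>F n in F. x n k = y k"
  shows "\<forall>\<^sub>F n in F. subst_point \<sigma> (x n) k = subst_point \<sigma> y k"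
  using eventually_agree[OF assms, where N = "nat \<bar>k\<bar>"]
proof eventually_elim
  fix n assume n: "agree (nat \<bar>k\<bar>) y (x n)"
  have eqs: "map (x n) [0..k] = map y [0..k]" "map (x n) [k..-1] = map y [k..-1]"
    using n by (auto simp: agree_def)
  show "subst_point \<sigma> (x n) k = subst_point \<sigma> y k"
    unfolding subst_point_def eqs ..
qed

section \<open>The shifts of a primitive directive sequence\<close>

lemma sublist_word: "sublist u (word x n) \<Longrightarrow> \<exists>s. u = word ((shift ^^ s) x) (length u)"
proof -
  assume "sublist u (word x n)"
  then obtain p q where pq: "word x n = p @ u @ q" by (auto simp: sublist_def)
  then have n: "n = length p + (length u + length q)" by (metis length_append length_word)
  have "word x n = word x (length p) @ word ((shift ^^ length p) x) (length u) @
      word ((shift ^^ length u) ((shift ^^ length p) x)) (length q)"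
    unfolding n word_add ..
  with pq have "u = word ((shift ^^ length p) x) (length u)" by simp
  then show ?thesis by blast
qed

lemma sublist_factor_window:
  "w \<in> factors x \<Longrightarrow> \<exists>N. sublist w (map x [- int N..int N])"
proof -
  assume "w \<in> factors x"
  then obtain i j where w: "w = map x [i..j]" by (auto simp: factors_def)
  show ?thesis
  proof (cases "i \<le> j")
    case True
    define N where "N = max (nat \<bar>i\<bar>) (nat \<bar>j\<bar>)"
    have *: "- int N \<le> i" "i \<le> j" "j \<le> int N" using True by (auto simp: N_def)
    have "[- int N..int N] = [- int N..i - 1] @ [i..j] @ [j + 1..int N]"
      using * upto_split1[of "- int N" i "int N"] upto_split2[of i j "int N"] by simp
    then show ?thesis unfolding w by (metis map_append sublist_appendI)
  qed (simp add: w)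
qed

lemma window_in_factors: "map x [- int N..int N] \<in> factors x"
  by (auto simp: factors_def)

text \<open>Membership in \<open>X\<^sup>(\<^sup>n\<^sup>)\<close> needs to be checked on centred windows only, which makes it visibly closed
  under pointwise limits.\<close>

lemma level_shift_iff:
  "x \<in> level_shift A \<tau> n \<longleftrightarrow> x \<in> points (A n) \<and>
     (\<forall>N. \<exists>m>n. \<exists>a\<in>A m. sublist (map x [- int N..int N]) (subst_comp \<tau> n m [a]))" (is "?L \<longleftrightarrow> ?R")
proof
  assume ?R
  have "\<exists>m>n. \<exists>a\<in>A m. sublist w (subst_comp \<tau> n m [a])" if "w \<in> factors x" for w
    using sublist_factor_window[OF that] \<open>?R\<close> by (meson sublist_order.order_trans)
  with \<open>?R\<close> show ?L by (simp add: level_shift_def)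
qed (simp add: level_shift_def window_in_factors)

lemma level_shift_points: "x \<in> level_shift A \<tau> n \<Longrightarrow> x \<in> points (A n)"
  by (simp add: level_shift_def)

lemma level_shift_translate:
  assumes "x \<in> level_shift A \<tau> n"
  shows "(\<lambda>k. x (k + d)) \<in> level_shift A \<tau> n"
proof -
  have "map (\<lambda>k. x (k + d)) [i..j] = map x [i + d..j + d]" for i j
    by (rule nth_equalityI) (auto simp: algebra_simps)
  then have "factors (\<lambda>k. x (k + d)) \<subseteq> factors x"
    by (auto simp: factors_def)
  with assms show ?thesis unfolding level_shift_def by blast
qed

lemma level_shift_funpow_shift:
  "x \<in> level_shift A \<tau> n \<Longrightarrow> (shift ^^ p) x \<in> level_shift A \<tau> n"
  unfolding funpow_shift by (rule level_shift_translate)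

lemma level_shift_closed:
  assumes F: "F \<noteq> bot" and x: "\<forall>\<^sub>F r in F. x r \<in> level_shift A \<tau> n"
    and lim: "\<And>k. \<forall>\<^sub>F r in F. x r k = y k"
  shows "y \<in> level_shift A \<tau> n"
  unfolding level_shift_iff
proof (intro conjI allI)
  have "\<forall>\<^sub>F r in F. y k \<in> A n" for k
    using x lim[of k] 
    by eventually_elim (metis (mono_tags) level_shift_points mem_Collect_eq)
  then show "y \<in> points (A n)" using eventually_happens'[OF F] by blast
  fix N
  have "\<forall>\<^sub>F r in F. \<exists>m>n. \<exists>a\<in>A m. sublist (map y [- int N..int N]) (subst_comp \<tau> n m [a])"
    using x eventually_agree[OF lim, where N = N]
  proof eventually_elim
    fix r assume r: "x r \<in> level_shift A \<tau> n" "agree N y (x r)"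
    then have eq: "map y [- int N..int N] = map (x r) [- int N..int N]" by (auto simp: agree_def)
    show "\<exists>m>n. \<exists>a\<in>A m. sublist (map y [- int N..int N]) (subst_comp \<tau> n m [a])"
      using r(1) unfolding level_shift_iff eq by blast
  qed
  then show "\<exists>m>n. \<exists>a\<in>A m. sublist (map y [- int N..int N]) (subst_comp \<tau> n m [a])"
    using eventually_happens'[OF F] by blast
qed

lemma language_level_shift_iff:
  "u \<in> language (level_shift A \<tau> n) \<longleftrightarrow> (\<exists>x\<in>level_shift A \<tau> n. u = word x (length u))"
proof
  assume "u \<in> language (level_shift A \<tau> n)"
  then obtain x i j where x: "x \<in> level_shift A \<tau> n" "u = map x [i..j]"
    by (auto simp: language_def factors_def)
  have "u = word (\<lambda>k. x (k + i)) (length u)"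
    unfolding x(2) by (rule nth_equalityI) (auto simp: add.commute)
  then show "\<exists>x\<in>level_shift A \<tau> n. u = word x (length u)"
    using level_shift_translate[OF x(1)] by blast
next
  assume "\<exists>x\<in>level_shift A \<tau> n. u = word x (length u)"
  then obtain x where x: "x \<in> level_shift A \<tau> n" "u = word x (length u)" by blast
  have "u = map x [0..int (length u) - 1]" unfolding word_eq_upto using x(2) by simp
  then have "u \<in> factors x" unfolding factors_def by blast
  then show "u \<in> language (level_shift A \<tau> n)"
    using x(1) by (auto simp: language_def)
qed

lemma word_in_language: "x \<in> level_shift A \<tau> n \<Longrightarrow> word x p \<in> language (level_shift A \<tau> n)"
  by (auto simp: language_level_shift_iff)

lemma subst_comp_refl [simp]: "subst_comp \<tau> n n = id"
  by (simp add: subst_comp_def fun_eq_iff)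

lemma subst_comp_split:
  "n \<le> m \<Longrightarrow> m \<le> k \<Longrightarrow> subst_comp \<tau> n k = subst_comp \<tau> n m \<circ> subst_comp \<tau> m k"
proof -
  assume "n \<le> m" "m \<le> k"
  then have "[n..<k] = [n..<m] @ [m..<k]"
    using upt_add_eq_append[of n m "k - m"] by simp
  then show ?thesis by (simp add: subst_comp_def foldr_append fun_eq_iff)
qed

locale primitive_directive_sequence =
  fixes A :: "nat \<Rightarrow> 'a set" and \<tau> :: "nat \<Rightarrow> 'a list \<Rightarrow> 'a list"
  assumes directive: "directive_sequence A \<tau>" and primitive: "primitive A \<tau>"
begin

abbreviation T :: "nat \<Rightarrow> nat \<Rightarrow> 'a list \<Rightarrow> 'a list" where
  "T \<equiv> subst_comp \<tau>"

abbreviation Y :: "nat \<Rightarrow> (int \<Rightarrow> 'a) set" where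
  "Y \<equiv> level_shift A \<tau>"

lemma finite_letters: "finite (A n)" and card_letters: "2 \<le> card (A n)"
  using directive by (auto simp: directive_sequence_def alphabet_def)

lemma letters_nonempty: "A n \<noteq> {}"
  using card_letters[of n] by auto

lemma substitution_T: "n \<le> m \<Longrightarrow> substitution (A m) (A n) (T n m)"
proof (induction m rule: dec_induct)
  case base
  then show ?case by (auto simp: substitution_def)
next
  case (step m)
  have "substitution (A (Suc m)) (A m) (\<tau> m)"
    using directive by (simp add: directive_sequence_def)
  then have "substitution (A (Suc m)) (A n) (T n m \<circ> \<tau> m)"
    by (rule substitution_comp) (rule step.IH)
  also have "T n m \<circ> \<tau> m = T n (Suc m)"
    using step.hyps by (simp add: subst_comp_def fun_eq_iff)
  finally show ?case .
qed

lemma point_T_comp: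
  assumes "n \<le> m" "m \<le> k" "x \<in> Y k"
  shows "subst_point (T n k) x = subst_point (T n m) (subst_point (T m k) x)"
  unfolding subst_comp_split[OF assms(1,2)]
  by (rule subst_point_comp[OF substitution_T substitution_T level_shift_points]) (use assms in auto)

lemma word_T:
  assumes "n \<le> m" "y \<in> Y m"
  shows "word (subst_point (T n m) y) (length (T n m (word y p))) = T n m (word y p)"
  using assms by (intro word_subst_point[OF substitution_T level_shift_points])

lemma point_T_funpow_shift:
  assumes "n \<le> m" "y \<in> Y m"
  shows "subst_point (T n m) ((shift ^^ p) y) = (shift ^^ length (T n m (word y p))) (subst_point (T n m) y)"
  using assms by (intro subst_point_funpow_shift[OF substitution_T level_shift_points])

lemma point_T_in_level_shift:
  assumes nm: "n \<le> m" and y: "y \<in> Y m"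
  shows "subst_point (T n m) y \<in> Y n"
  unfolding level_shift_iff
proof (intro conjI allI)
  note \<sigma> = substitution_T[OF nm]
  note yA = level_shift_points[OF y]
  define z where "z = subst_point (T n m) y"
  show "subst_point (T n m) y \<in> points (A n)" by (rule subst_point_in_points[OF \<sigma> yA])
  fix N
  define L R where "L = length (T n m (left_word y N))" and "R = length (T n m (word y (Suc N)))"
  have LR: "N \<le> L" "Suc N \<le> R"
    using substitution_length_ge[OF \<sigma> left_word_in_lists[OF yA, of N]]
      substitution_length_ge[OF \<sigma> word_in_lists[OF yA, of "Suc N"]] by (auto simp: L_def R_def)
  have "left_word z L = left_word (\<lambda>k. z (k - int N)) (L - N) @ left_word z N"
    "word z R = word z (Suc N) @ word ((shift ^^ Suc N) z) (R - Suc N)"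
    using left_word_add[of z "L - N" N] word_add[of z "Suc N" "R - Suc N"] LR by auto
  then have "sublist (map z [- int N..int N]) (left_word z L @ word z R)"
    unfolding window_eq by (metis append.assoc sublist_appendI)
  also have "left_word z L @ word z R = T n m (left_word y N @ word y (Suc N))"
    unfolding z_def L_def R_def
    by (simp only: left_word_subst_point[OF \<sigma> yA] word_subst_point[OF \<sigma> yA]
        substitution_append[OF \<sigma> left_word_in_lists[OF yA] word_in_lists[OF yA]])
  finally have z: "sublist (map z [- int N..int N]) (T n m (map y [- int N..int N]))"
    by (simp only: window_eq)
  obtain k a where k: "k > m" "a \<in> A k" "sublist (map y [- int N..int N]) (T m k [a])"
    using y unfolding level_shift_iff by blast
  have "T m k [a] \<in> lists (A m)"
    using k by (intro substitution_in_lists[OF substitution_T]) auto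
  then have "sublist (T n m (map y [- int N..int N])) (T n k [a])"
    using substitution_sublist[OF \<sigma> _ k(3)] k(1) subst_comp_split[OF nm, of k \<tau>] by simp
  with z have "sublist (map z [- int N..int N]) (T n k [a])"
    by (rule sublist_order.order_trans)
  then show "\<exists>k>n. \<exists>a\<in>A k. sublist (map (subst_point (T n m) y) [- int N..int N]) (T n k [a])"
    using k nm unfolding z_def by (intro exI[of _ k] conjI bexI[of _ a]) auto
qed

text \<open>By primitivity every letter of \<open>A M\<close> occurs in the image of each letter of a later level. There
  are two letters at least, so the length of the images grows.\<close>

lemma eventually_length_T_ge:
  "\<forall>\<^sub>F m in sequentially. \<forall>a\<in>A m. H \<le> length (T n m [a])"
proof (induction H)
  case (Suc H)
  then obtain M0 where M0: "\<And>m a. m \<ge> M0 \<Longrightarrow> a \<in> A m \<Longrightarrow> H \<le> length (T n m [a])"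
    unfolding eventually_sequentially by blast
  define M where "M = max M0 n"
  have M: "n \<le> M" "M0 \<le> M" by (auto simp: M_def)
  obtain K where K: "K > M" "\<And>a. a \<in> A K \<Longrightarrow> A M \<subseteq> set (T M K [a])"
    using primitive unfolding primitive_def by blast
  have "Suc H \<le> length (T n m [a])" if m: "m \<ge> K" and a: "a \<in> A m" for m a
  proof -
    define u where "u = T M m [a]"
    have u: "u \<in> lists (A M)"
      unfolding u_def using K m a by (intro substitution_in_lists[OF substitution_T]) auto
    have "T K m [a] \<in> lists (A K)"
      using m a by (intro substitution_in_lists[OF substitution_T]) auto
    moreover have "T K m [a] \<noteq> []"
      using substitution_length_ge[OF substitution_T[OF m], of "[a]"] a by auto
    ultimately obtain b where b: "b \<in> A K" "b \<in> set (T K m [a])"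
      by (meson in_lists_conv_set last_in_set)
    have "sublist [b] (T K m [a])" using split_list[OF b(2)] by (auto simp: sublist_def)
    then have "sublist (T M K [b]) u"
      using substitution_sublist[OF substitution_T[of M K]] K(1) m \<open>T K m [a] \<in> lists (A K)\<close>
      unfolding u_def by (simp add: subst_comp_split[of M K m])
    then have "A M \<subseteq> set u" using K(2)[OF b(1)] set_mono_sublist by blast
    then have "card (A M) \<le> length u" using card_mono[of "set u" "A M"] card_length[of u] by simp
    then have "2 \<le> length u" using card_letters[of M] by simp
    then obtain c where c: "c \<in> set u" by (cases u) auto
    have "H \<le> length (T n M [c])" using c u M by (intro M0) auto
    then show ?thesis
      using substitution_length_ge_letter[OF substitution_T[OF M(1)] u c] \<open>2 \<le> length u\<close> K m M
      by (simp add: u_def subst_comp_split[of n M m])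
  qed
  then show ?case unfolding eventually_sequentially by blast
qed simp

text \<open>Points of \<open>Y n\<close> are limits of ever longer images of letters, with the origin moved to the middle.\<close>

lemma level_shift_nonempty: "Y n \<noteq> {}"
proof -
  have "\<exists>m>n. \<exists>a\<in>A m. 2 * k + 1 \<le> length (T n m [a])" for k
  proof -
    have "\<forall>\<^sub>F m in sequentially. m > n \<and> (\<forall>a\<in>A m. 2 * k + 1 \<le> length (T n m [a]))"
      by (intro eventually_conj eventually_gt_at_top eventually_length_T_ge)
    then obtain m where "m > n" "\<forall>a\<in>A m. 2 * k + 1 \<le> length (T n m [a])"
      using eventually_happens'[OF sequentially_bot] by blast
    then show ?thesis using letters_nonempty[of m] by blast
  qed
  then obtain m a where m: "\<And>k. m k > n" "\<And>k. a k \<in> A (m k)"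
    "\<And>k. 2 * k + 1 \<le> length (T n (m k) [a k])" by metis
  define w where "w = (\<lambda>k. T n (m k) [a k])"
  define x where "x = (\<lambda>k i. if - int k \<le> i \<and> i \<le> int k then w k ! nat (i + int k) else w k ! 0)"
  have w: "w k \<in> lists (A n)" for k
    unfolding w_def using m[of k] by (intro substitution_in_lists[OF substitution_T]) auto
  have "w k ! j \<in> A n" if "j \<le> 2 * k" for k j
    using w[of k] m(3)[of k] that unfolding w_def
    by (metis Suc_eq_plus1 in_lists_conv_set le_imp_less_Suc nth_mem order_less_le_trans)
  then have "x k i \<in> A n" for k i unfolding x_def by auto
  then obtain r y where r: "strict_mono (r :: nat \<Rightarrow> nat)" and y: "\<forall>i. y i \<in> A n"
    and lim: "\<And>i. \<forall>\<^sub>F k in sequentially. x (r k) i = y i"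
    using pointwise_convergent_subsequence[OF finite_letters, of x n] by blast
  have "\<exists>m>n. \<exists>a\<in>A m. sublist (map y [- int N..int N]) (T n m [a])" for N
  proof -
    have "\<forall>\<^sub>F k in sequentially. agree N y (x (r k)) \<and> k \<ge> N"
      by (intro eventually_conj eventually_agree lim eventually_ge_at_top)
    then obtain k where k: "agree N y (x (r k))" "k \<ge> N"
      using eventually_happens'[OF sequentially_bot] by blast
    define K where "K = r k"
    have K: "N \<le> K" using seq_suble[OF r, of k] k(2) by (simp add: K_def)
    have "map y [- int N..int N] = take (2 * N + 1) (drop (K - N) (w K))"
    proof (rule nth_equalityI)
      fix j assume "j < length (map y [- int N..int N])"
      then have j: "j < 2 * N + 1" by simp
      have "y (- int N + int j) = x K (- int N + int j)"
        using k(1) j by (auto simp: agree_def K_def)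
      also have "\<dots> = w K ! (K - N + j)"
      proof -
        have "nat (- int N + int j + int K) = K - N + j" using K by simp
        then show ?thesis unfolding x_def using j K by simp
      qed
      finally show "map y [- int N..int N] ! j = take (2 * N + 1) (drop (K - N) (w K)) ! j"
        using j K m(3)[of K] by (simp add: w_def)
    qed (use K m(3)[of K] in \<open>simp add: w_def\<close>)
    then have "sublist (map y [- int N..int N]) (w K)"
      by (metis sublist_drop sublist_order.order_trans sublist_take)
    then show ?thesis using m[of K] unfolding w_def by blast
  qed
  then show ?thesis using y level_shift_iff[of y A \<tau> n] by blast
qed

lemma letter_occurs:
  assumes a: "a \<in> A n"
  shows "\<exists>y\<in>Y n. y 0 = a"
proof -
  obtain M where M: "M > n" "\<forall>b\<in>A M. a \<in> set (T n M [b])"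
    using primitive a unfolding primitive_def by blast
  obtain z where z: "z \<in> Y M" using level_shift_nonempty by blast
  define y where "y = subst_point (T n M) z"
  have y: "y \<in> Y n" unfolding y_def using M z by (intro point_T_in_level_shift) auto
  have "z 0 \<in> A M" using level_shift_points[OF z] by simp
  then have "a \<in> set (T n M (word z 1))" using M by (simp add: word_1)
  then have "a \<in> set (word y (length (T n M (word z 1))))"
    using word_T[of n M z 1] M(1) z by (simp add: y_def)
  then obtain j where "y (int j) = a" by (auto simp: word_def)
  then have "((shift ^^ j) y) 0 = a" by (simp add: funpow_shift)
  then show ?thesis using level_shift_funpow_shift[OF y, of j] by blast
qed

end

section \<open>Points that are desubstituted at every level with origin zero\<close>

context primitive_directive_sequence
begin

definition core :: "(int \<Rightarrow> 'a) set" where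
  "core = {x. \<forall>m. \<exists>y\<in>Y m. x = subst_point (T 0 m) y}"

lemma core_subset: "core \<subseteq> Y 0"
proof
  fix x assume "x \<in> core"
  then have "\<forall>m. \<exists>y\<in>Y m. x = subst_point (T 0 m) y" by (simp add: core_def)
  then obtain y where "y \<in> Y 0" "x = subst_point (T 0 0) y" by blast
  then show "x \<in> Y 0" using point_T_in_level_shift[of 0 0 y] by simp
qed

text \<open>Desubstituting to level \<open>j\<close> is possible along the whole tail of the sequence; a limit of these
  preimages is a preimage of the limit. Hence a common preimage exists at every level without any
  coherence between the chosen points.\<close>

lemma limit_in_core:
  assumes y: "\<And>k. y k \<in> Y (m k)" and m: "\<And>k. k \<le> m k"
  shows "\<exists>r x. strict_mono (r :: nat \<Rightarrow> nat) \<and> x \<in> core \<and>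
    (\<forall>i. \<forall>\<^sub>F k in sequentially. subst_point (T 0 (m (r k))) (y (r k)) i = x i)"
proof -
  define X where "X = (\<lambda>k. subst_point (T 0 (m k)) (y k))"
  have "X k \<in> Y 0" for k
    unfolding X_def by (intro point_T_in_level_shift y) simp
  then have "X k i \<in> A 0" for k i using level_shift_points by blast
  then obtain r x where r: "strict_mono (r :: nat \<Rightarrow> nat)"
    and x: "\<And>i. \<forall>\<^sub>F k in sequentially. X (r k) i = x i"
    using pointwise_convergent_subsequence[OF finite_letters, of X 0] by blast
  have "\<exists>z\<in>Y j. x = subst_point (T 0 j) z" for j
  proof -
    define v where "v = (\<lambda>k. subst_point (T j (m (r (k + j)))) (y (r (k + j))))"
    have le: "j \<le> m (r (k + j))" for k
      using seq_suble[OF r, of "k + j"] m[of "r (k + j)"] by simp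
    have v: "v k \<in> Y j" for k
      unfolding v_def by (intro point_T_in_level_shift le y)
    then have "v k i \<in> A j" for k i using level_shift_points by blast
    then obtain s z where s: "strict_mono (s :: nat \<Rightarrow> nat)"
      and z: "\<And>i. \<forall>\<^sub>F k in sequentially. v (s k) i = z i"
      using pointwise_convergent_subsequence[OF finite_letters, of v j] by blast
    have "z \<in> Y j"
      by (rule level_shift_closed[OF sequentially_bot _ z]) (simp add: v)
    moreover have "x i = subst_point (T 0 j) z i" for i
    proof -
      have "strict_mono (\<lambda>k. s k + j)" using s by (simp add: strict_mono_def)
      then have "\<forall>\<^sub>F k in sequentially. X (r (s k + j)) i = x i"
        using x[of i] by (rule eventually_subseq)
      moreover have "X (r (s k + j)) = subst_point (T 0 j) (v (s k))" for k
        unfolding X_def v_def by (rule point_T_comp[OF _ le y]) simp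
      ultimately have "\<forall>\<^sub>F k in sequentially. subst_point (T 0 j) (v (s k)) i = x i" by simp
      moreover have "\<forall>\<^sub>F k in sequentially. subst_point (T 0 j) (v (s k)) i = subst_point (T 0 j) z i"
        by (rule eventually_subst_point[OF z])
      ultimately have "\<forall>\<^sub>F k in sequentially. x i = subst_point (T 0 j) z i"
        by eventually_elim simp
      then show ?thesis using eventually_happens'[OF sequentially_bot] by blast
    qed
    ultimately show ?thesis by blast
  qed
  then have "x \<in> core" by (simp add: core_def)
  with r x show ?thesis unfolding X_def by blast
qed

lemma core_nonempty: "core \<noteq> {}"
proof -
  have "(SOME y. y \<in> Y k) \<in> Y k" for k
    using level_shift_nonempty[of k] by (simp add: some_in_eq)
  then show ?thesis using limit_in_core[of "\<lambda>k. SOME y. y \<in> Y k" "\<lambda>k. k"] by blast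
qed

text \<open>By primitivity a given word lies in the image of every letter of some deep level, in particular in
  the image that the core point reads to the right of the origin. Nonnegative shifts therefore suffice.\<close>

lemma core_orbit_dense:
  assumes x0: "x0 \<in> core" and x: "x \<in> Y 0"
  shows "\<exists>k. agree N x ((shift ^^ k) x0)"
proof -
  obtain m a where m: "a \<in> A m" "sublist (map x [- int N..int N]) (T 0 m [a])"
    using x unfolding level_shift_iff by blast
  obtain M where M: "M > m" "\<forall>b\<in>A M. a \<in> set (T m M [b])"
    using primitive m(1) unfolding primitive_def by blast
  obtain z where z: "z \<in> Y M" "x0 = subst_point (T 0 M) z" using x0 by (auto simp: core_def)
  have "z 0 \<in> A M" using level_shift_points[OF z(1)] by simp
  then have "a \<in> set (T m M [z 0])" "T m M [z 0] \<in> lists (A m)"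
    using M substitution_in_lists[OF substitution_T[of m M]] by auto
  then have "sublist [a] (T m M [z 0])" "T m M [z 0] \<in> lists (A m)"
    by (auto simp: sublist_def dest!: split_list)
  then have "sublist (T 0 m [a]) (T 0 M [z 0])"
    using substitution_sublist[OF substitution_T[of 0 m]] subst_comp_split[of 0 m M \<tau>] M by simp
  with m(2) have "sublist (map x [- int N..int N]) (T 0 M (word z 1))"
    by (metis One_nat_def sublist_order.order_trans word_1)
  then have "sublist (map x [- int N..int N]) (word x0 (length (T 0 M (word z 1))))"
    using word_T[of 0 M z 1] z by simp
  then obtain s where s: "map x [- int N..int N] = word ((shift ^^ s) x0) (2 * N + 1)"
    using sublist_word by (metis window_eq_word length_word)
  have "agree N x ((shift ^^ (s + N)) x0)"
    unfolding agree_def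
  proof (intro allI impI)
    fix i :: int assume i: "\<bar>i\<bar> \<le> int N"
    define j where "j = nat (i + int N)"
    have j: "i = int j - int N" "j < 2 * N + 1" using i by (auto simp: j_def)
    have "x (int j - int N) = x0 (int j + int s)"
      using arg_cong[OF s, of "\<lambda>w. w ! j"] j(2) unfolding window_eq_word by (simp add: funpow_shift)
    then show "x i = (shift ^^ (s + N)) x0 i"
      unfolding j(1) by (simp add: funpow_shift)
  qed
  then show ?thesis ..
qed

section \<open>Heights and letter-coboundaries along levels\<close>

lemma height_append:
  "u \<in> lists (A n) \<Longrightarrow> v \<in> lists (A n) \<Longrightarrow> height \<tau> n (u @ v) = height \<tau> n u + height \<tau> n v"
  unfolding height_def by (simp add: substitution_append[OF substitution_T])

lemma height_T: "n \<le> m \<Longrightarrow> height \<tau> n (T n m u) = height \<tau> m u"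
  unfolding height_def using subst_comp_split[of 0 n m \<tau>] by simp

lemma height_pos: "a \<in> A n \<Longrightarrow> 0 < height \<tau> n [a]"
  using substitution_length_ge[OF substitution_T[of 0 n], of "[a]"] unfolding height_def
  by (simp only: in_lists_conv_set) auto

lemma point_T_0:
  assumes "n \<le> m" "y \<in> Y m"
  shows "subst_point (T n m) y 0 = hd (T n m [y 0])"
proof -
  have "y 0 \<in> A m" using level_shift_points[OF assms(2)] by simp
  then have "0 < length (T n m [y 0])"
    using substitution_length_ge[OF substitution_T[OF assms(1)], of "[y 0]"]
    by (cases "T n m [y 0]") auto
  moreover from this have "hd (T n m [y 0]) = T n m [y 0] ! 0" by (intro hd_conv_nth) auto
  ultimately show ?thesis
    using word_T[OF assms, of 1] nth_word[of 0 "length (T n m [y 0])" "subst_point (T n m) y"]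
    by (simp add: word_1 del: nth_word)
qed

lemma T_language:
  assumes "n \<le> m" "u \<in> language (Y m)"
  shows "T n m u \<in> language (Y n)"
proof -
  obtain y where y: "y \<in> Y m" "u = word y (length u)"
    using assms(2) language_level_shift_iff by blast
  show ?thesis
    using word_T[OF assms(1) y(1), of "length u"] y point_T_in_level_shift[OF assms(1) y(1)]
    by (metis word_in_language)
qed

lemma language_in_lists: "u \<in> language (Y n) \<Longrightarrow> u \<in> lists (A n)"
  using language_level_shift_iff word_in_lists level_shift_points by metis

lemma coboundary_append:
  "letter_coboundary (A n) (Y n) c \<Longrightarrow> u \<in> lists (A n) \<Longrightarrow> v \<in> lists (A n) \<Longrightarrow> c (u @ v) = c u + c v"
  by (simp add: letter_coboundary_def)

text \<open>A block between two occurrences of one letter is a product of return words to it.\<close>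

lemma coboundary_loop:
  assumes c: "letter_coboundary (A n) (Y n) c"
  shows "y \<in> Y n \<Longrightarrow> y (int p) = y 0 \<Longrightarrow> c (word y p) = 0"
proof (induction p arbitrary: y rule: less_induct)
  case (less p)
  note y = less.prems(1)
  show ?case
  proof (cases "p = 0")
    case True
    then show ?thesis using c by (simp add: letter_coboundary_def)
  next
    case False
    define q where "q = (LEAST q. 0 < q \<and> y (int q) = y 0)"
    have q: "0 < q" "y (int q) = y 0" "q \<le> p"
      using LeastI[of "\<lambda>q. 0 < q \<and> y (int q) = y 0" p] False less.prems(2)
        Least_le[of "\<lambda>q. 0 < q \<and> y (int q) = y 0" p] unfolding q_def by auto
    have q_least: "y (int j) \<noteq> y 0" if "0 < j" "j < q" for j
      using not_less_Least[of j "\<lambda>q. 0 < q \<and> y (int q) = y 0"] that unfolding q_def by blast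
    obtain q' where q': "q = 1 + q'" using q(1) by (cases q) auto
    have w: "word y q = [y 0] @ word (shift y) q'"
      unfolding q' word_add by (simp add: word_1)
    have "count_list (word (shift y) q') (y 0) = 0"
      using q_least by (auto simp: count_list_0_iff word_def shift_def q')
        (metis One_nat_def add.commute less_Suc_eq_0_disj not_less_eq of_nat_1 of_nat_add zero_less_Suc plus_1_eq_Suc)
    then have "count_list (word y q @ [y 0]) (y 0) = 2"
      unfolding w by simp
    moreover have "word y q @ [y 0] \<in> language (Y n)"
      using word_in_language[OF y, of "Suc q"] q(2) by (simp add: word_Suc)
    ultimately have "return_word (Y n) (y 0) (word y q)"
      unfolding return_word_def w by (simp add: suffix_def)
    moreover have "y 0 \<in> A n" using level_shift_points[OF y] by simp
    ultimately have cq: "c (word y q) = 0"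
      using c unfolding letter_coboundary_def by blast
    define z where "z = (shift ^^ q) y"
    have z: "z \<in> Y n" unfolding z_def by (rule level_shift_funpow_shift[OF y])
    have "z (int (p - q)) = z 0"
      using q less.prems(2) by (simp add: z_def funpow_shift of_nat_diff)
    then have "c (word z (p - q)) = 0"
      using q(1,3) by (intro less.IH z) auto
    moreover have "word y p = word y q @ word z (p - q)"
      using word_add[of y q "p - q"] q(3) by (simp add: z_def)
    ultimately show ?thesis
      using cq coboundary_append[OF c word_in_lists[OF level_shift_points[OF y], of q]
          word_in_lists[OF level_shift_points[OF z], of "p - q"]] by simp
  qed
qed

text \<open>Images of words from a letter to itself again lead from a letter to itself, since the first letter
  of an image is determined by the first letter of the word.\<close>

lemma coboundary_pullback:
  assumes c: "letter_coboundary (A n) (Y n) c" and nm: "n \<le> m"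
  shows "letter_coboundary (A m) (Y m) (\<lambda>u. c (T n m u))"
  unfolding letter_coboundary_def
proof (intro conjI ballI allI impI)
  note \<sigma> = substitution_T[OF nm]
  show "c (T n m []) = 0"
    using c \<sigma> by (simp add: letter_coboundary_def substitution_def)
  show "c (T n m (u @ v)) = c (T n m u) + c (T n m v)" if "u \<in> lists (A m)" "v \<in> lists (A m)" for u v
    using that substitution_in_lists[OF \<sigma>]
    by (simp add: substitution_append[OF \<sigma>] coboundary_append[OF c])
  fix a w assume "return_word (Y m) a w"
  then have w: "w @ [a] \<in> language (Y m)" "prefix [a] (w @ [a])" by (auto simp: return_word_def)
  define p where "p = length w"
  obtain y where y: "y \<in> Y m" "w @ [a] = word y (Suc p)"
    using w(1) unfolding language_level_shift_iff p_def by auto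
  have wp: "w = word y p" "y (int p) = a" using y(2) by (auto simp: word_Suc p_def)
  have y0: "y 0 = a"
    using w(2) nth_word[of 0 "Suc p" y] unfolding y(2) by (auto simp: prefix_def simp del: nth_word)
  define v where "v = subst_point (T n m) y"
  define q where "q = length (T n m (word y p))"
  have v: "v \<in> Y n" unfolding v_def by (rule point_T_in_level_shift[OF nm y(1)])
  have "v (int q) = ((shift ^^ q) v) 0" by (simp add: funpow_shift)
  also have "\<dots> = subst_point (T n m) ((shift ^^ p) y) 0"
    unfolding v_def q_def point_T_funpow_shift[OF nm y(1)] ..
  also have "\<dots> = hd (T n m [y (int p)])"
    using point_T_0[OF nm level_shift_funpow_shift[OF y(1)], of p] by (simp add: funpow_shift)
  also have "\<dots> = v 0"
    unfolding v_def point_T_0[OF nm y(1)] wp(2) y0 ..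
  finally have "c (word v q) = 0" by (rule coboundary_loop[OF c v])
  then show "c (T n m w) = 0"
    unfolding wp(1) v_def q_def word_T[OF nm y(1)] .
qed

end

text \<open>Over a nonempty set a supremum of nonnegative numbers is nonnegative (over the empty set it would be
  \<open>-\<infinity>\<close>), so convergence to zero amounts to uniform upper bounds.\<close>

lemma SUP_tendsto_0_iff:
  fixes f :: "nat \<Rightarrow> 'b \<Rightarrow> real"
  assumes pos: "\<And>m u. 0 \<le> f m u" and L: "\<And>m. L m \<noteq> {}"
  shows "((\<lambda>m. SUP u\<in>L m. ereal (f m u)) \<longlonglongrightarrow> 0) \<longleftrightarrow>
    (\<forall>e>0. \<forall>\<^sub>F m in sequentially. \<forall>u\<in>L m. f m u \<le> e)" (is "?lim \<longleftrightarrow> ?bound")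
proof
  assume lim: ?lim
  show ?bound
  proof (intro allI impI)
    fix e :: real assume "0 < e"
    then have "\<forall>\<^sub>F m in sequentially. (SUP u\<in>L m. ereal (f m u)) < ereal e"
      using lim by (intro order_tendstoD(2)[OF lim]) simp
    then show "\<forall>\<^sub>F m in sequentially. \<forall>u\<in>L m. f m u \<le> e"
    proof eventually_elim
      fix m assume m: "(SUP u\<in>L m. ereal (f m u)) < ereal e"
      have "ereal (f m u) < ereal e" if "u \<in> L m" for u
        using SUP_upper[OF that, of "\<lambda>u. ereal (f m u)"] m by (rule le_less_trans)
      then show "\<forall>u\<in>L m. f m u \<le> e" by force
    qed
  qed
next
  assume bound: ?bound
  show ?lim
  proof (rule order_tendstoI)
    fix a :: ereal assume a: "a < 0"
    have "a < (SUP u\<in>L m. ereal (f m u))" for m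
    proof -
      obtain u where u: "u \<in> L m" using L by blast
      have "a < ereal (f m u)" using a pos[of m u] by (simp add: less_le_trans)
      then show ?thesis using SUP_upper[OF u, of "\<lambda>u. ereal (f m u)"] by (rule less_le_trans)
    qed
    then show "\<forall>\<^sub>F m in sequentially. a < (SUP u\<in>L m. ereal (f m u))" by simp
  next
    fix a :: ereal assume "0 < a"
    then obtain e where e: "0 < ereal e" "ereal e < a" using ereal_dense2 by blast
    then have "\<forall>\<^sub>F m in sequentially. \<forall>u\<in>L m. f m u \<le> e" using bound by simp
    then show "\<forall>\<^sub>F m in sequentially. (SUP u\<in>L m. ereal (f m u)) < a"
    proof eventually_elim
      fix m assume "\<forall>u\<in>L m. f m u \<le> e"
      then have "(SUP u\<in>L m. ereal (f m u)) \<le> ereal e" by (intro SUP_least) simp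
      then show "(SUP u\<in>L m. ereal (f m u)) < a" using e(2) by (rule le_less_trans)
    qed
  qed
qed

section \<open>From an eigenfunction to a letter-coboundary\<close>

locale eigenfunction = primitive_directive_sequence A \<tau>
  for A :: "nat \<Rightarrow> 'a set" and \<tau> :: "nat \<Rightarrow> 'a list \<Rightarrow> 'a list" +
  fixes g :: "(int \<Rightarrow> 'a) \<Rightarrow> real" and \<alpha> :: real
  assumes continuous:
      "\<And>x e. x \<in> Y 0 \<Longrightarrow> 0 < e \<Longrightarrow> \<exists>N. \<forall>y\<in>Y 0. agree N x y \<longrightarrow> int_dist (g y - g x) < e"
    and equivariant: "\<And>x. x \<in> Y 0 \<Longrightarrow> g (shift x) - (g x + \<alpha>) \<in> \<int>"
begin

lemma equivariant_funpow:
  assumes x: "x \<in> Y 0"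
  shows "g ((shift ^^ p) x) - (g x + \<alpha> * real p) \<in> \<int>"
proof (induction p)
  case (Suc p)
  have "g (shift ((shift ^^ p) x)) - (g ((shift ^^ p) x) + \<alpha>) \<in> \<int>"
    by (rule equivariant[OF level_shift_funpow_shift[OF x]])
  from Ints_add[OF this Suc.IH] show ?case by (simp add: algebra_simps)
qed simp

lemma uniformly_continuous:
  assumes e: "0 < e"
  shows "\<exists>N. \<forall>x\<in>Y 0. \<forall>y\<in>Y 0. agree N x y \<longrightarrow> int_dist (g x - g y) \<le> e"
proof (rule ccontr)
  assume "\<not> ?thesis"
  then have "\<forall>N. \<exists>x\<in>Y 0. \<exists>y\<in>Y 0. agree N x y \<and> e < int_dist (g x - g y)"
    by (meson not_le)
  then obtain x y where xy: "\<And>N. x N \<in> Y 0" "\<And>N. y N \<in> Y 0" "\<And>N. agree N (x N) (y N)"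
    "\<And>N. e < int_dist (g (x N) - g (y N))" by metis
  have "x N i \<in> A 0" for N i using level_shift_points[OF xy(1)] by simp
  then obtain r z where r: "strict_mono (r :: nat \<Rightarrow> nat)"
    and z: "\<And>i. \<forall>\<^sub>F k in sequentially. x (r k) i = z i"
    using pointwise_convergent_subsequence[OF finite_letters, of x 0] by blast
  have zY: "z \<in> Y 0"
    by (rule level_shift_closed[OF sequentially_bot _ z]) (simp add: xy)
  obtain N where N: "\<And>y. y \<in> Y 0 \<Longrightarrow> agree N z y \<Longrightarrow> int_dist (g y - g z) < e / 2"
    using continuous[OF zY, of "e / 2"] e by auto
  have "\<forall>\<^sub>F k in sequentially. agree N z (x (r k)) \<and> k \<ge> N"
    by (intro eventually_conj eventually_agree z eventually_ge_at_top)
  then obtain k where k: "agree N z (x (r k))" "k \<ge> N"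
    using eventually_happens'[OF sequentially_bot] by blast
  have "N \<le> r k" using seq_suble[OF r, of k] k(2) by simp
  then have k': "agree N z (y (r k))"
    using agree_trans[OF k(1) agree_mono[OF xy(3)]] by blast
  have "int_dist (g (x (r k)) - g (y (r k))) \<le> int_dist (g (x (r k)) - g z) + int_dist (g (y (r k)) - g z)"
    using int_dist_triangle'[of "g (x (r k))" "g (y (r k))" "g z"]
      int_dist_commute[of "g z" "g (y (r k))"] by simp
  then show False
    using N[OF xy(1) k(1)] N[OF xy(2) k'] xy(4)[of "r k"] by simp
qed

text \<open>Two points of one tower base agree only to the right of the origin. Moving both into the middle of
  the tower makes them agree on a large centred window and changes their values under \<open>g\<close> by the
  same amount, so \<open>g\<close> is almost constant on tower bases.\<close>

lemma base_oscillation: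
  assumes e: "0 < e"
  shows "\<forall>\<^sub>F m in sequentially. \<forall>y\<in>Y m. \<forall>z\<in>Y m. y 0 = z 0 \<longrightarrow>
    int_dist (g (subst_point (T 0 m) y) - g (subst_point (T 0 m) z)) \<le> e"
proof -
  obtain N where N: "\<And>x y. x \<in> Y 0 \<Longrightarrow> y \<in> Y 0 \<Longrightarrow> agree N x y \<Longrightarrow> int_dist (g x - g y) \<le> e"
    using uniformly_continuous[OF e] by blast
  show ?thesis
    using eventually_length_T_ge[of "2 * N + 1" 0]
  proof eventually_elim
    fix m assume m: "\<forall>a\<in>A m. 2 * N + 1 \<le> length (T 0 m [a])"
    show "\<forall>y\<in>Y m. \<forall>z\<in>Y m. y 0 = z 0 \<longrightarrow>
      int_dist (g (subst_point (T 0 m) y) - g (subst_point (T 0 m) z)) \<le> e"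
    proof (intro ballI impI)
      fix y z assume y: "y \<in> Y m" and z: "z \<in> Y m" and yz: "y 0 = z 0"
      define x x' where "x = subst_point (T 0 m) y" and "x' = subst_point (T 0 m) z"
      have x: "x \<in> Y 0" "x' \<in> Y 0"
        unfolding x_def x'_def by (auto intro: point_T_in_level_shift y z)
      define L where "L = length (T 0 m [y 0])"
      have L: "2 * N + 1 \<le> L" using m level_shift_points[OF y] by (simp add: L_def)
      have "word x L = word x' L"
        using word_T[of 0 m y 1] word_T[of 0 m z 1] y z yz
        by (simp add: word_1 x_def x'_def L_def)
      then have eq: "x (int j) = x' (int j)" if "j < L" for j
        using nth_word[OF that, of x] nth_word[OF that, of x'] by simp
      have "agree N ((shift ^^ N) x) ((shift ^^ N) x')"
        unfolding agree_def
      proof (intro allI impI)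
        fix i :: int assume i: "\<bar>i\<bar> \<le> int N"
        have "i + int N = int (nat (i + int N))" "nat (i + int N) < L" using i L by auto
        then show "(shift ^^ N) x i = (shift ^^ N) x' i"
          using eq[of "nat (i + int N)"] by (simp add: funpow_shift)
      qed
      then have "int_dist (g ((shift ^^ N) x) - g ((shift ^^ N) x')) \<le> e"
        by (intro N level_shift_funpow_shift x)
      moreover have "g ((shift ^^ N) x) - g ((shift ^^ N) x') - (g x - g x') \<in> \<int>"
        using Ints_diff[OF equivariant_funpow[OF x(1), of N] equivariant_funpow[OF x(2), of N]]
        by (simp add: algebra_simps)
      ultimately have "int_dist (g x - g x') \<le> e" by (simp add: int_dist_cong)
      then show "int_dist (g (subst_point (T 0 m) y) - g (subst_point (T 0 m) z)) \<le> e"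
        by (simp add: x_def x'_def)
    qed
  qed
qed

text \<open>The values of the eigenfunction on the core as points of the circle, represented in \<open>[0, 1)\<close>.\<close>

definition core_values :: "real set" where
  "core_values = (\<lambda>x. frac (g x)) ` core"

text \<open>At a deep level, core points in one tower base have almost the same value. More values than
  letters would force two distinct values into one base; this is where the number of letters has to be
  bounded.\<close>

lemma finite_core_values:
  assumes bdd: "bdd_above (range (\<lambda>n. card (A n)))"
  shows "finite core_values"
proof (rule ccontr)
  assume inf: "infinite core_values"
  obtain K where K: "\<And>n. card (A n) \<le> K" using bdd unfolding bdd_above_def by auto
  obtain S where S: "finite S" "card S = Suc K" "S \<subseteq> core_values"
    using infinite_arbitrarily_large[OF inf] by blast
  have "core_values \<subseteq> {0..<1}" by (auto simp: core_values_def frac_lt_1)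
  then obtain d where d: "0 < d" "\<And>s t. s \<in> S \<Longrightarrow> t \<in> S \<Longrightarrow> s \<noteq> t \<Longrightarrow> d < int_dist (s - t)"
    using separated_mod_1[OF S(1)] S(3) by (meson order_trans)
  obtain m where m: "\<And>y z. y \<in> Y m \<Longrightarrow> z \<in> Y m \<Longrightarrow> y 0 = z 0 \<Longrightarrow>
      int_dist (g (subst_point (T 0 m) y) - g (subst_point (T 0 m) z)) \<le> d"
    using eventually_happens'[OF sequentially_bot base_oscillation[OF d(1)]] by blast
  have "\<exists>y\<in>Y m. s = frac (g (subst_point (T 0 m) y))" if "s \<in> S" for s
    using S(3) that unfolding core_values_def core_def by force
  then obtain y where y: "\<And>s. s \<in> S \<Longrightarrow> y s \<in> Y m"
    "\<And>s. s \<in> S \<Longrightarrow> s = frac (g (subst_point (T 0 m) (y s)))" by metis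
  have "(\<lambda>s. y s 0) ` S \<subseteq> A m" using y(1) level_shift_points by blast
  then have "card ((\<lambda>s. y s 0) ` S) \<le> K"
    using card_mono[OF finite_letters] K order_trans by blast
  then have "\<not> inj_on (\<lambda>s. y s 0) S" using S(2) by (intro pigeonhole) simp
  then obtain s t where st: "s \<in> S" "t \<in> S" "s \<noteq> t" "y s 0 = y t 0"
    by (auto simp: inj_on_def)
  have "int_dist (s - t) = int_dist (g (subst_point (T 0 m) (y s)) - g (subst_point (T 0 m) (y t)))"
    using y(2)[OF st(1)] y(2)[OF st(2)] int_dist_frac by metis
  then show False using d(2)[OF st(1-3)] m[OF y(1)[OF st(1)] y(1)[OF st(2)] st(4)] by simp
qed

text \<open>Bases of increasing level accumulate only at points that lie in a base of every level.\<close>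

lemma eventually_near_core_values:
  assumes e: "0 < e"
  shows "\<forall>\<^sub>F m in sequentially. \<forall>y\<in>Y m. \<exists>s\<in>core_values. int_dist (g (subst_point (T 0 m) y) - s) \<le> e"
proof (rule ccontr)
  assume "\<not> ?thesis"
  then have "\<forall>k. \<exists>m\<ge>k. \<exists>y\<in>Y m. \<forall>s\<in>core_values. e < int_dist (g (subst_point (T 0 m) y) - s)"
    unfolding eventually_sequentially by (meson not_le)
  then obtain m y where my: "\<And>k. k \<le> m k" "\<And>k. y k \<in> Y (m k)"
    "\<And>k s. s \<in> core_values \<Longrightarrow> e < int_dist (g (subst_point (T 0 (m k)) (y k)) - s)" by metis
  obtain r x where x: "x \<in> core"
    and lim: "\<And>i. \<forall>\<^sub>F k in sequentially. subst_point (T 0 (m (r k))) (y (r k)) i = x i"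
    using limit_in_core[of y m, OF my(2,1)] by blast
  obtain N where N: "\<And>z. z \<in> Y 0 \<Longrightarrow> agree N x z \<Longrightarrow> int_dist (g z - g x) < e"
    using continuous[of x e] core_subset x e by blast
  have "\<forall>\<^sub>F k in sequentially. agree N x (subst_point (T 0 (m (r k))) (y (r k)))"
    by (rule eventually_agree[OF lim])
  then obtain k where "agree N x (subst_point (T 0 (m (r k))) (y (r k)))"
    using eventually_happens'[OF sequentially_bot] by blast
  then have "int_dist (g (subst_point (T 0 (m (r k))) (y (r k))) - g x) < e"
    by (intro N point_T_in_level_shift my(2)) simp
  moreover have "frac (g x) \<in> core_values" using x by (simp add: core_values_def)
  ultimately show False using my(3)[of "frac (g x)" "r k"] by (simp add: int_dist_frac)
qed

text \<open>Fix a level on whose tower bases \<open>g\<close> varies much less than the gaps between core values. Each base then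
  selects one core value, its label. Deeper bases lie in bases of the fixed level and close to core
  values, so they have to be close to the label. Two letters that may follow the same letter have nearby
  bases, hence the same label; so the increment of the label is a function of the letter alone.\<close>

lemma letter_labels:
  assumes bdd: "bdd_above (range (\<lambda>n. card (A n)))"
  shows "\<exists>n \<rho>.
    (\<forall>y\<in>Y n. \<forall>z\<in>Y n. y 0 = z 0 \<longrightarrow> \<rho> (y 1) = \<rho> (z 1)) \<and>
    (\<forall>e>0. \<forall>\<^sub>F m in sequentially. \<forall>y\<in>Y m.
       int_dist (g (subst_point (T 0 m) y) - \<rho> (subst_point (T n m) y 0)) \<le> e)"
proof -
  have "core_values \<subseteq> {0..<1}" by (auto simp: core_values_def frac_lt_1)
  then obtain d where d: "0 < d"
    "\<And>s t. s \<in> core_values \<Longrightarrow> t \<in> core_values \<Longrightarrow> s \<noteq> t \<Longrightarrow> d < int_dist (s - t)"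
    using separated_mod_1[OF finite_core_values[OF bdd]] by blast
  \<comment> \<open>Labels of two possible followers differ by at most \<open>2b + b + 2b\<close>, and a core value near a deep base
    differs from the label by at most \<open>b + 2b\<close>; both have to stay below the gap \<open>d\<close>.\<close>
  define b where "b = d / 8"
  have b: "0 < b" "8 * b = d" using d(1) by (auto simp: b_def)
  have "\<forall>\<^sub>F n in sequentially.
    (\<forall>y\<in>Y n. \<forall>z\<in>Y n. y 0 = z 0 \<longrightarrow>
      int_dist (g (subst_point (T 0 n) y) - g (subst_point (T 0 n) z)) \<le> b) \<and>
    (\<forall>y\<in>Y n. \<exists>s\<in>core_values. int_dist (g (subst_point (T 0 n) y) - s) \<le> b)"
    by (intro eventually_conj base_oscillation eventually_near_core_values b)
  then obtain n where
    osc: "\<And>y z. y \<in> Y n \<Longrightarrow> z \<in> Y n \<Longrightarrow> y 0 = z 0 \<Longrightarrow>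
      int_dist (g (subst_point (T 0 n) y) - g (subst_point (T 0 n) z)) \<le> b" and
    near: "\<And>y. y \<in> Y n \<Longrightarrow> \<exists>s\<in>core_values. int_dist (g (subst_point (T 0 n) y) - s) \<le> b"
    using eventually_happens'[OF sequentially_bot] by blast
  have "\<exists>s\<in>core_values. \<forall>y\<in>Y n. y 0 = a \<longrightarrow> int_dist (g (subst_point (T 0 n) y) - s) \<le> 2 * b"
    if a: "a \<in> A n" for a
  proof -
    obtain z where z: "z \<in> Y n" "z 0 = a" using letter_occurs[OF a] by blast
    obtain s where s: "s \<in> core_values" "int_dist (g (subst_point (T 0 n) z) - s) \<le> b"
      using near[OF z(1)] by blast
    have "int_dist (g (subst_point (T 0 n) y) - s) \<le> 2 * b" if "y \<in> Y n" "y 0 = a" for y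
      using int_dist_triangle'[of "g (subst_point (T 0 n) y)" s "g (subst_point (T 0 n) z)"]
        osc[OF that(1) z(1)] that(2) z(2) s(2) by simp
    with s(1) show ?thesis by blast
  qed
  then obtain \<rho> where \<rho>: "\<And>a. a \<in> A n \<Longrightarrow> \<rho> a \<in> core_values"
    "\<And>a y. a \<in> A n \<Longrightarrow> y \<in> Y n \<Longrightarrow> y 0 = a \<Longrightarrow> int_dist (g (subst_point (T 0 n) y) - \<rho> a) \<le> 2 * b"
    by metis
  have letter: "y k \<in> A n" if "y \<in> Y n" for y k using level_shift_points[OF that] by simp
  have "\<rho> (y 1) = \<rho> (z 1)" if y: "y \<in> Y n" and z: "z \<in> Y n" and yz: "y 0 = z 0" for y z
  proof (rule ccontr)
    assume "\<rho> (y 1) \<noteq> \<rho> (z 1)"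
    then have far: "d < int_dist (\<rho> (y 1) - \<rho> (z 1))" by (intro d \<rho> letter y z)
    define x x' where "x = subst_point (T 0 n) y" and "x' = subst_point (T 0 n) z"
    define h where "h = length (T 0 n [y 0])"
    have x: "x \<in> Y 0" "x' \<in> Y 0"
      unfolding x_def x'_def by (auto intro: point_T_in_level_shift y z)
    have Sx: "subst_point (T 0 n) ((shift ^^ 1) y) = (shift ^^ h) x"
      "subst_point (T 0 n) ((shift ^^ 1) z) = (shift ^^ h) x'"
      using point_T_funpow_shift[of 0 n y 1] point_T_funpow_shift[of 0 n z 1] y z yz
      by (simp_all add: h_def x_def x'_def word_1)
    have "int_dist (g x - g x') \<le> b"
      unfolding x_def x'_def by (rule osc[OF y z yz])
    moreover have "int_dist (g ((shift ^^ h) x) - g ((shift ^^ h) x')) = int_dist (g x - g x')"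
      using Ints_diff[OF equivariant_funpow[OF x(1), of h] equivariant_funpow[OF x(2), of h]]
      by (intro int_dist_cong) (simp add: algebra_simps)
    moreover have "int_dist (g ((shift ^^ h) x) - \<rho> (y 1)) \<le> 2 * b"
      using \<rho>(2)[OF letter[OF y] level_shift_funpow_shift[OF y, of 1], of 1]
      unfolding Sx by (simp add: funpow_shift shift_def)
    moreover have "int_dist (g ((shift ^^ h) x') - \<rho> (z 1)) \<le> 2 * b"
      using \<rho>(2)[OF letter[OF z] level_shift_funpow_shift[OF z, of 1], of 1]
      unfolding Sx by (simp add: funpow_shift shift_def)
    ultimately show False
      using far b int_dist_triangle'[of "\<rho> (y 1)" "\<rho> (z 1)" "g ((shift ^^ h) x)"]
        int_dist_triangle'[of "g ((shift ^^ h) x)" "\<rho> (z 1)" "g ((shift ^^ h) x')"]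
        int_dist_commute[of "\<rho> (y 1)" "g ((shift ^^ h) x)"] by linarith
  qed
  moreover have "\<forall>\<^sub>F m in sequentially. \<forall>y\<in>Y m.
      int_dist (g (subst_point (T 0 m) y) - \<rho> (subst_point (T n m) y 0)) \<le> e" if e: "0 < e" for e
  proof -
    have "0 < min e b" using e b by simp
    from eventually_near_core_values[OF this] eventually_ge_at_top[of n]
    show ?thesis
    proof eventually_elim
      fix m assume m: "\<forall>y\<in>Y m. \<exists>s\<in>core_values. int_dist (g (subst_point (T 0 m) y) - s) \<le> min e b"
        and nm: "n \<le> m"
      show "\<forall>y\<in>Y m. int_dist (g (subst_point (T 0 m) y) - \<rho> (subst_point (T n m) y 0)) \<le> e"
      proof
        fix y assume y: "y \<in> Y m"
        define x v where "x = subst_point (T 0 m) y" and "v = subst_point (T n m) y"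
        have v: "v \<in> Y n" unfolding v_def by (rule point_T_in_level_shift[OF nm y])
        have xv: "x = subst_point (T 0 n) v"
          unfolding x_def v_def by (rule point_T_comp[OF _ nm y]) simp
        obtain s where s: "s \<in> core_values" "int_dist (g x - s) \<le> min e b"
          using m y unfolding x_def by blast
        have "int_dist (g x - \<rho> (v 0)) \<le> 2 * b"
          unfolding xv by (rule \<rho>(2)[OF letter[OF v] v]) simp
        then have "int_dist (s - \<rho> (v 0)) \<le> 3 * b"
          using int_dist_triangle'[of s "\<rho> (v 0)" "g x"] int_dist_commute[of s "g x"] s(2) by simp
        then have "s = \<rho> (v 0)"
          using d(2)[OF s(1) \<rho>(1)[OF letter[OF v]], of 0] b by fastforce
        then show "int_dist (g (subst_point (T 0 m) y) - \<rho> (subst_point (T n m) y 0)) \<le> e"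
          using s(2) by (simp add: x_def v_def)
      qed
    qed
  qed
  ultimately show ?thesis by blast
qed

text \<open>Summing label increments telescopes. On a word \<open>u\<close> of level \<open>m\<close> the sum compares the labels at both
  ends, which approximate values of \<open>g\<close> that differ by \<open>\<alpha> h\<^sub>m(u)\<close> modulo one.\<close>

lemma coboundary_of_eigenfunction:
  assumes bdd: "bdd_above (range (\<lambda>n. card (A n)))"
  shows "\<exists>n c. letter_coboundary (A n) (Y n) c \<and>
    (\<forall>e>0. \<forall>\<^sub>F m in sequentially. \<forall>u\<in>language (Y m).
       int_dist (c (T n m u) - \<alpha> * real (height \<tau> m u)) \<le> e)"
proof -
  obtain n \<rho> where
    follow: "\<And>y z. y \<in> Y n \<Longrightarrow> z \<in> Y n \<Longrightarrow> y 0 = z 0 \<Longrightarrow> \<rho> (y 1) = \<rho> (z 1)" and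
    label: "\<And>e. 0 < e \<Longrightarrow> \<forall>\<^sub>F m in sequentially. \<forall>y\<in>Y m.
       int_dist (g (subst_point (T 0 m) y) - \<rho> (subst_point (T n m) y 0)) \<le> e"
    using letter_labels[OF bdd] by blast
  define \<kappa> where "\<kappa> = (\<lambda>a. \<rho> ((SOME y. y \<in> Y n \<and> y 0 = a) 1) - \<rho> a)"
  define c where "c = (\<lambda>w. \<Sum>a\<leftarrow>w. \<kappa> a)"
  have \<kappa>: "\<kappa> (y 0) = \<rho> (y 1) - \<rho> (y 0)" if "y \<in> Y n" for y
  proof -
    define z where "z = (SOME z. z \<in> Y n \<and> z 0 = y 0)"
    have "z \<in> Y n \<and> z 0 = y 0" unfolding z_def by (rule someI[of _ y]) (simp add: that)
    then have "\<rho> (z 1) = \<rho> (y 1)" using follow that by blast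
    then show ?thesis by (simp add: \<kappa>_def z_def)
  qed
  have c_word: "c (word y p) = \<rho> (y (int p)) - \<rho> (y 0)" if y: "y \<in> Y n" for y p
  proof (induction p)
    case (Suc p)
    have "\<kappa> (y (int p)) = \<rho> (y (int p + 1)) - \<rho> (y (int p))"
      using \<kappa>[OF level_shift_funpow_shift[OF y, of p]] by (simp add: funpow_shift add.commute)
    with Suc show ?case by (simp add: word_Suc c_def add.commute)
  qed (simp add: c_def)
  have "letter_coboundary (A n) (Y n) c"
    unfolding letter_coboundary_def
  proof (intro conjI ballI allI impI)
    fix a w assume "return_word (Y n) a w"
    then have w: "w @ [a] \<in> language (Y n)" "prefix [a] (w @ [a])" by (auto simp: return_word_def)
    define p where "p = length w"
    obtain y where y: "y \<in> Y n" "w @ [a] = word y (Suc p)"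
      using w(1) unfolding language_level_shift_iff p_def by auto
    have wp: "w = word y p" "y (int p) = a" using y(2) by (auto simp: word_Suc p_def)
    have "y 0 = a"
      using w(2) nth_word[of 0 "Suc p" y] unfolding y(2) by (auto simp: prefix_def simp del: nth_word)
    then show "c w = 0" unfolding wp(1) c_word[OF y(1)] using wp(2) by simp
  qed (auto simp: c_def)
  moreover have "\<forall>\<^sub>F m in sequentially. \<forall>u\<in>language (Y m).
       int_dist (c (T n m u) - \<alpha> * real (height \<tau> m u)) \<le> e" if e: "0 < e" for e
  proof -
    have "0 < e / 2" using e by simp
    from label[OF this] eventually_ge_at_top[of n] show ?thesis
    proof eventually_elim
      fix m assume m: "\<forall>y\<in>Y m. int_dist (g (subst_point (T 0 m) y) - \<rho> (subst_point (T n m) y 0)) \<le> e / 2"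
        and nm: "n \<le> m"
      show "\<forall>u\<in>language (Y m). int_dist (c (T n m u) - \<alpha> * real (height \<tau> m u)) \<le> e"
      proof
        fix u assume "u \<in> language (Y m)"
        then obtain y where y: "y \<in> Y m" and u: "u = word y (length u)"
          using language_level_shift_iff by blast
        define p where "p = length u"
        have u: "u = word y p" using u by (simp add: p_def)
        define x v q z where "x = subst_point (T 0 m) y" and "v = subst_point (T n m) y"
          and "q = length (T n m u)" and "z = (shift ^^ p) y"
        have v: "v \<in> Y n" unfolding v_def by (rule point_T_in_level_shift[OF nm y])
        have x: "x \<in> Y 0" unfolding x_def by (rule point_T_in_level_shift[OF _ y]) simp
        have z: "z \<in> Y m" unfolding z_def by (rule level_shift_funpow_shift[OF y])
        have cu: "c (T n m u) = \<rho> (v (int q)) - \<rho> (v 0)"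
          using c_word[OF v, of q] word_T[OF nm y, of p] by (simp add: v_def q_def u)
        have vq: "v (int q) = subst_point (T n m) z 0"
          unfolding z_def point_T_funpow_shift[OF nm y] by (simp add: funpow_shift v_def q_def u)
        have gz: "g (subst_point (T 0 m) z) - (g x + \<alpha> * real (height \<tau> m u)) \<in> \<int>"
          unfolding z_def point_T_funpow_shift[of 0 m, OF _ y, simplified]
          using equivariant_funpow[OF x, of "height \<tau> m u"] by (simp add: x_def height_def u)
        from cu vq have "c (T n m u) - \<alpha> * real (height \<tau> m u) -
            ((\<rho> (subst_point (T n m) z 0) - g (subst_point (T 0 m) z)) + (g x - \<rho> (v 0))) =
            g (subst_point (T 0 m) z) - (g x + \<alpha> * real (height \<tau> m u))"
          by simp
        with gz have "c (T n m u) - \<alpha> * real (height \<tau> m u) -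
            ((\<rho> (subst_point (T n m) z 0) - g (subst_point (T 0 m) z)) + (g x - \<rho> (v 0))) \<in> \<int>"
          by (simp only:)
        then have "int_dist (c (T n m u) - \<alpha> * real (height \<tau> m u)) =
            int_dist ((\<rho> (subst_point (T n m) z 0) - g (subst_point (T 0 m) z)) + (g x - \<rho> (v 0)))"
          by (rule int_dist_cong)
        also have "\<dots> \<le> e / 2 + e / 2"
          using int_dist_triangle m[rule_format, OF y] m[rule_format, OF z]
            int_dist_commute[of "\<rho> (subst_point (T n m) z 0)" "g (subst_point (T 0 m) z)"]
          unfolding x_def v_def by (smt (verit))
        finally show "int_dist (c (T n m u) - \<alpha> * real (height \<tau> m u)) \<le> e" by simp
      qed
    qed
  qed
  ultimately show ?thesis by blast
qed

end

section \<open>Lifting small values modulo one to small real values\<close>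

lemma centered_frac_diff: "x - centered_frac x \<in> \<int>"
  by (simp add: centered_frac_def)

lemma abs_centered_frac: "\<bar>centered_frac x\<bar> = int_dist x"
  by (simp add: centered_frac_def int_dist_def)

lemma int_dist_eq_abs: "\<bar>x\<bar> < 1 / 2 \<Longrightarrow> int_dist x = \<bar>x\<bar>"
  unfolding int_dist_def using round_unique'[of x 0] by simp

context primitive_directive_sequence
begin

text \<open>The monoid morphism \<open>\<gamma>\<^sub>n\<close>.\<close>

definition lifted_error :: "real \<Rightarrow> nat \<Rightarrow> ('a list \<Rightarrow> real) \<Rightarrow> 'a list \<Rightarrow> real" where
  "lifted_error \<alpha> n c w = (\<Sum>a\<leftarrow>w. centered_frac (c [a] - \<alpha> * real (height \<tau> n [a])))"

lemma lifted_error_Ints: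
  assumes c: "letter_coboundary (A n) (Y n) c"
  shows "u \<in> lists (A n) \<Longrightarrow> lifted_error \<alpha> n c u - (c u - \<alpha> * real (height \<tau> n u)) \<in> \<int>"
proof (induction u)
  case Nil
  have "c [] = 0" "height \<tau> n [] = 0"
    using c substitution_T[of 0 n] by (simp_all add: letter_coboundary_def height_def substitution_def)
  then show ?case by (simp add: lifted_error_def)
next
  case (Cons a u)
  have "c ([a] @ u) = c [a] + c u" "height \<tau> n ([a] @ u) = height \<tau> n [a] + height \<tau> n u"
    using Cons.prems by (intro coboundary_append[OF c] height_append; simp)+
  then have "lifted_error \<alpha> n c (a # u) - (c (a # u) - \<alpha> * real (height \<tau> n (a # u))) =
      (lifted_error \<alpha> n c u - (c u - \<alpha> * real (height \<tau> n u))) -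
      ((c [a] - \<alpha> * real (height \<tau> n [a])) - centered_frac (c [a] - \<alpha> * real (height \<tau> n [a])))"
    by (simp add: lifted_error_def algebra_simps)
  moreover have "lifted_error \<alpha> n c u - (c u - \<alpha> * real (height \<tau> n u)) \<in> \<int>"
    using Cons.prems by (intro Cons.IH) simp
  ultimately show ?case using Ints_diff[OF _ centered_frac_diff] by simp
qed

lemma int_dist_lifted_error:
  assumes c: "letter_coboundary (A n) (Y n) c" and nm: "n \<le> m" and u: "u \<in> language (Y m)"
  shows "int_dist (lifted_error \<alpha> n c (T n m u)) = int_dist (c (T n m u) - \<alpha> * real (height \<tau> m u))"
  using int_dist_cong[OF lifted_error_Ints[OF c language_in_lists[OF T_language[OF nm u]], of \<alpha>]]
  by (simp add: height_T[OF nm])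

text \<open>Once all words of a level have an error below \<open>1/8\<close> modulo one, reading a word letter by
  letter moves the real error by at most \<open>1/8\<close> at a time, starting from zero. It can therefore never
  leave the interval around zero for one around another integer.\<close>

lemma lifted_error_bound:
  assumes c: "letter_coboundary (A n) (Y n) c"
    and bound: "\<And>u. u \<in> language (Y n) \<Longrightarrow> int_dist (c u - \<alpha> * real (height \<tau> n u)) \<le> 1 / 8"
    and u: "u \<in> language (Y n)"
  shows "\<bar>lifted_error \<alpha> n c u\<bar> \<le> 1 / 8"
proof -
  obtain y where y: "y \<in> Y n" "u = word y (length u)"
    using u language_level_shift_iff by blast
  have "\<bar>lifted_error \<alpha> n c (word y p)\<bar> \<le> 1 / 8" for p
  proof (induction p)
    case (Suc p)
    define a where "a = y (int p)"
    have "word ((shift ^^ p) y) 1 \<in> language (Y n)"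
      by (rule word_in_language[OF level_shift_funpow_shift[OF y(1)]])
    then have "[a] \<in> language (Y n)" by (simp add: word_1 funpow_shift a_def)
    then have "\<bar>centered_frac (c [a] - \<alpha> * real (height \<tau> n [a]))\<bar> \<le> 1 / 8"
      unfolding abs_centered_frac by (rule bound)
    moreover have "lifted_error \<alpha> n c (word y (Suc p)) =
        lifted_error \<alpha> n c (word y p) + centered_frac (c [a] - \<alpha> * real (height \<tau> n [a]))"
      by (simp add: lifted_error_def word_Suc a_def)
    ultimately have "\<bar>lifted_error \<alpha> n c (word y (Suc p))\<bar> < 1 / 2"
      using Suc.IH by linarith
    then have "\<bar>lifted_error \<alpha> n c (word y (Suc p))\<bar> = int_dist (lifted_error \<alpha> n c (word y (Suc p)))"
      by (simp add: int_dist_eq_abs)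
    also have "\<dots> = int_dist (c (word y (Suc p)) - \<alpha> * real (height \<tau> n (word y (Suc p))))"
      using int_dist_lifted_error[OF c order_refl word_in_language[OF y(1)]] by simp
    also have "\<dots> \<le> 1 / 8" by (intro bound word_in_language y)
    finally show ?case .
  qed (simp add: lifted_error_def)
  then show ?thesis using y(2) by metis
qed

lemma real_error_of_mod_1_error:
  assumes c: "letter_coboundary (A n) (Y n) c"
    and small: "\<And>e. 0 < e \<Longrightarrow> \<forall>\<^sub>F m in sequentially. \<forall>u\<in>language (Y m).
       int_dist (c (T n m u) - \<alpha> * real (height \<tau> m u)) \<le> e"
  shows "\<exists>n c. letter_coboundary (A n) (Y n) c \<and>
    (\<forall>e>0. \<forall>\<^sub>F m in sequentially. \<forall>u\<in>language (Y m). \<bar>lifted_error \<alpha> n c (T n m u)\<bar> \<le> e)"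
proof -
  have "\<forall>\<^sub>F m in sequentially. n \<le> m \<and>
      (\<forall>u\<in>language (Y m). int_dist (c (T n m u) - \<alpha> * real (height \<tau> m u)) \<le> 1 / 8)"
    by (intro eventually_conj eventually_ge_at_top small) simp
  then obtain N where N: "n \<le> N"
    "\<And>u. u \<in> language (Y N) \<Longrightarrow> int_dist (c (T n N u) - \<alpha> * real (height \<tau> N u)) \<le> 1 / 8"
    using eventually_happens'[OF sequentially_bot] by blast
  define c' where "c' = (\<lambda>u. c (T n N u))"
  have c': "letter_coboundary (A N) (Y N) c'"
    unfolding c'_def by (rule coboundary_pullback[OF c N(1)])
  have bound: "\<bar>lifted_error \<alpha> N c' u\<bar> \<le> 1 / 8" if "u \<in> language (Y N)" for u
    by (rule lifted_error_bound[OF c' _ that], unfold c'_def) (rule N(2))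
  have "\<forall>\<^sub>F m in sequentially. \<forall>u\<in>language (Y m). \<bar>lifted_error \<alpha> N c' (T N m u)\<bar> \<le> e"
    if e: "0 < e" for e
    using small[OF e] eventually_ge_at_top[of N]
  proof eventually_elim
    fix m assume m: "\<forall>u\<in>language (Y m). int_dist (c (T n m u) - \<alpha> * real (height \<tau> m u)) \<le> e"
      and Nm: "N \<le> m"
    show "\<forall>u\<in>language (Y m). \<bar>lifted_error \<alpha> N c' (T N m u)\<bar> \<le> e"
    proof
      fix u assume u: "u \<in> language (Y m)"
      have "\<bar>lifted_error \<alpha> N c' (T N m u)\<bar> = int_dist (lifted_error \<alpha> N c' (T N m u))"
        using bound[OF T_language[OF Nm u]] by (simp add: int_dist_eq_abs)
      also have "\<dots> = int_dist (c (T n m u) - \<alpha> * real (height \<tau> m u))"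
        using int_dist_lifted_error[OF c' Nm u] subst_comp_split[OF N(1) Nm, of \<tau>]
        by (simp add: c'_def)
      also have "\<dots> \<le> e" using m u by blast
      finally show "\<bar>lifted_error \<alpha> N c' (T N m u)\<bar> \<le> e" .
    qed
  qed
  with c' show ?thesis by blast
qed

lemma mod_1_error_of_real_error:
  assumes c: "letter_coboundary (A n) (Y n) c"
    and small: "\<forall>\<^sub>F m in sequentially. \<forall>u\<in>language (Y m). \<bar>lifted_error \<alpha> n c (T n m u)\<bar> \<le> e"
  shows "\<forall>\<^sub>F m in sequentially. \<forall>u\<in>language (Y m).
    int_dist (c (T n m u) - \<alpha> * real (height \<tau> m u)) \<le> e"
  using small eventually_ge_at_top[of n]
proof eventually_elim
  fix m assume "\<forall>u\<in>language (Y m). \<bar>lifted_error \<alpha> n c (T n m u)\<bar> \<le> e" and nm: "n \<le> m"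
  then show "\<forall>u\<in>language (Y m). int_dist (c (T n m u) - \<alpha> * real (height \<tau> m u)) \<le> e"
    using int_dist_lifted_error[OF c nm] int_dist_le_abs order_trans by metis
qed

section \<open>From a letter-coboundary to an eigenfunction\<close>

lemma tower_position:
  assumes y: "y \<in> Y m"
  shows "\<exists>p j. j < height \<tau> m [y (int p)] \<and> k = height \<tau> m (word y p) + j"
proof (induction k)
  case 0
  have "0 < height \<tau> m [y (int 0)]" using level_shift_points[OF y] by (intro height_pos) simp
  moreover have "height \<tau> m (word y 0) = 0"
    using substitution_T[of 0 m] by (simp add: height_def substitution_def)
  ultimately show ?case by (metis add_0)
next
  case (Suc k)
  then obtain p j where pj: "j < height \<tau> m [y (int p)]" "k = height \<tau> m (word y p) + j" by blast
  show ?case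
  proof (cases "Suc j < height \<tau> m [y (int p)]")
    case True
    then show ?thesis using pj(2) by (metis add_Suc_right)
  next
    case False
    have "height \<tau> m (word y (Suc p)) = height \<tau> m (word y p) + height \<tau> m [y (int p)]"
      unfolding word_Suc using level_shift_points[OF y]
      by (intro height_append word_in_lists) auto
    then have "Suc k = height \<tau> m (word y (Suc p)) + 0" using False pj by simp
    moreover have "0 < height \<tau> m [y (int (Suc p))]"
      using level_shift_points[OF y] by (intro height_pos) blast
    ultimately show ?thesis by blast
  qed
qed

text \<open>Disjointness of the towers improves by compactness: a finite window already determines the tower
  and the position in it. Two sequences of parametrized points that agree on growing windows converge,
  along a subsequence with constant parameters, to one point lying in both towers.\<close>

lemma window_determines_tower:
  assumes rec: "recognizable A \<tau>" and m: "1 \<le> m"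
  shows "\<exists>N. \<forall>y\<in>Y m. \<forall>z\<in>Y m. \<forall>j<height \<tau> m [y 0]. \<forall>k<height \<tau> m [z 0].
    agree N ((shift ^^ j) (subst_point (T 0 m) y)) ((shift ^^ k) (subst_point (T 0 m) z)) \<longrightarrow>
    y 0 = z 0 \<and> j = k" (is ?goal)
proof (rule ccontr)
  assume neg: "\<not> ?goal"
  define bad where "bad = (\<lambda>N y z j k. y \<in> Y m \<and> z \<in> Y m \<and> j < height \<tau> m [y 0] \<and> k < height \<tau> m [z 0] \<and>
    agree N ((shift ^^ j) (subst_point (T 0 m) y)) ((shift ^^ k) (subst_point (T 0 m) z)) \<and>
    \<not> (y 0 = z 0 \<and> j = k))"
  have "\<exists>y z j k. bad N y z j k" for N
  proof (rule ccontr)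
    assume "\<nexists>y z j k. bad N y z j k"
    then have "y 0 = z 0 \<and> j = k"
      if "y \<in> Y m" "z \<in> Y m" "j < height \<tau> m [y 0]" "k < height \<tau> m [z 0]"
        "agree N ((shift ^^ j) (subst_point (T 0 m) y)) ((shift ^^ k) (subst_point (T 0 m) z))"
      for y z j k
      using that unfolding bad_def by metis
    then have ?goal by (intro exI[of _ N]) simp
    with neg show False ..
  qed
  then obtain y z j k where "\<And>N. bad N (y N) (z N) (j N) (k N)" by metis
  then have yz: "\<And>N. y N \<in> Y m" "\<And>N. z N \<in> Y m"
    and jk: "\<And>N. j N < height \<tau> m [y N 0]" "\<And>N. k N < height \<tau> m [z N 0]"
    and agree: "\<And>N. agree N ((shift ^^ j N) (subst_point (T 0 m) (y N)))
      ((shift ^^ k N) (subst_point (T 0 m) (z N)))"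
    and differ: "\<And>N. \<not> (y N 0 = z N 0 \<and> j N = k N)"
    unfolding bad_def by simp_all
  have letter: "x i \<in> A m" if "x \<in> Y m" for x i using level_shift_points[OF that] by simp
  define H where "H = Max ((\<lambda>a. height \<tau> m [a]) ` A m)"
  have H: "height \<tau> m [a] \<le> H" if "a \<in> A m" for a
    unfolding H_def using finite_letters that by (intro Max_ge) auto
  \<comment> \<open>Packing everything into one sequence over a finite set gives a common convergent subsequence.\<close>
  define w where "w = (\<lambda>N i. (y N i, z N i, j N, k N))"
  have "finite (A m \<times> A m \<times> {..H} \<times> {..H})" using finite_letters by simp
  moreover have "w N i \<in> A m \<times> A m \<times> {..H} \<times> {..H}" for N i
    using letter yz jk[of N] H[OF letter[OF yz(1)], of N 0] H[OF letter[OF yz(2)], of N 0]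
    by (simp add: w_def less_imp_le less_le_trans)
  ultimately obtain r v where r: "strict_mono (r :: nat \<Rightarrow> nat)"
    and v: "\<And>i. \<forall>\<^sub>F N in sequentially. w (r N) i = v i"
    using pointwise_convergent_subsequence[of "A m \<times> A m \<times> {..H} \<times> {..H}" w] by blast
  define y' z' j' k' where "y' = (\<lambda>i. fst (v i))" and "z' = (\<lambda>i. fst (snd (v i)))"
    and "j' = fst (snd (snd (v 0)))" and "k' = snd (snd (snd (v 0)))"
  have lim: "\<forall>\<^sub>F N in sequentially. y (r N) i = y' i" "\<forall>\<^sub>F N in sequentially. z (r N) i = z' i"
    "\<forall>\<^sub>F N in sequentially. j (r N) = j'" "\<forall>\<^sub>F N in sequentially. k (r N) = k'" for i
  proof -
    have v': "\<forall>\<^sub>F N in sequentially. v i = (y (r N) i, z (r N) i, j (r N), k (r N))" for i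
      using v[of i] by eventually_elim (simp add: w_def)
    show "\<forall>\<^sub>F N in sequentially. y (r N) i = y' i"
      using v'[of i] by eventually_elim (simp add: y'_def)
    show "\<forall>\<^sub>F N in sequentially. z (r N) i = z' i"
      using v'[of i] by eventually_elim (simp add: z'_def)
    show "\<forall>\<^sub>F N in sequentially. j (r N) = j'"
      using v'[of 0] by eventually_elim (simp add: j'_def)
    show "\<forall>\<^sub>F N in sequentially. k (r N) = k'"
      using v'[of 0] by eventually_elim (simp add: k'_def)
  qed
  have y': "y' \<in> Y m" and z': "z' \<in> Y m"
    using level_shift_closed[OF sequentially_bot _ lim(1)] level_shift_closed[OF sequentially_bot _ lim(2)]
    by (simp_all add: yz)
  have "\<forall>\<^sub>F N in sequentially. y (r N) 0 = y' 0 \<and> z (r N) 0 = z' 0 \<and> j (r N) = j' \<and> k (r N) = k'"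
    by (intro eventually_conj lim)
  then obtain N where N: "y (r N) 0 = y' 0" "z (r N) 0 = z' 0" "j (r N) = j'" "k (r N) = k'"
    using eventually_happens'[OF sequentially_bot] by blast
  have j': "j' < height \<tau> m [y' 0]" and k': "k' < height \<tau> m [z' 0]"
    using jk[of "r N"] N by simp_all
  have differ': "\<not> (y' 0 = z' 0 \<and> j' = k')" using differ[of "r N"] N by simp
  have "(shift ^^ j') (subst_point (T 0 m) y') i = (shift ^^ k') (subst_point (T 0 m) z') i" for i
  proof -
    have "\<forall>\<^sub>F N in sequentially. subst_point (T 0 m) (y (r N)) (i + int j') = subst_point (T 0 m) y' (i + int j')"
      "\<forall>\<^sub>F N in sequentially. subst_point (T 0 m) (z (r N)) (i + int k') = subst_point (T 0 m) z' (i + int k')"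
      by (rule eventually_subst_point[OF lim(1)], rule eventually_subst_point[OF lim(2)])
    then have "\<forall>\<^sub>F N in sequentially. (shift ^^ j') (subst_point (T 0 m) y') i = (shift ^^ k') (subst_point (T 0 m) z') i"
      using lim(3,4) eventually_ge_at_top[of "nat \<bar>i\<bar>"]
    proof eventually_elim
      fix N assume N: "subst_point (T 0 m) (y (r N)) (i + int j') = subst_point (T 0 m) y' (i + int j')"
        "subst_point (T 0 m) (z (r N)) (i + int k') = subst_point (T 0 m) z' (i + int k')"
        "j (r N) = j'" "k (r N) = k'" "nat \<bar>i\<bar> \<le> N"
      have "\<bar>i\<bar> \<le> int (r N)" using N(5) seq_suble[OF r, of N] by linarith
      then show "(shift ^^ j') (subst_point (T 0 m) y') i = (shift ^^ k') (subst_point (T 0 m) z') i"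
        using agree[of "r N"] N(1-4) by (simp add: agree_def funpow_shift)
    qed
    then show ?thesis using eventually_happens'[OF sequentially_bot] by blast
  qed
  then have "(shift ^^ j') (subst_point (T 0 m) y') = (shift ^^ k') (subst_point (T 0 m) z')" by blast
  then have "(shift ^^ j') (subst_point (T 0 m) y') \<in>
      (shift ^^ j') ` base A \<tau> m (y' 0) \<inter> (shift ^^ k') ` base A \<tau> m (z' 0)"
    unfolding base_def using y' z' by blast
  moreover have "(y' 0, j') \<noteq> (z' 0, k')" using differ' by simp
  moreover have "disjoint_family_on (\<lambda>(a, k). (shift ^^ k) ` base A \<tau> m a)
      {(a, k). a \<in> A m \<and> k < height \<tau> m [a]}"
    using rec m unfolding recognizable_def by blast
  ultimately show False
    using j' k' letter[OF y', of 0] letter[OF z', of 0] unfolding disjoint_family_on_def by force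
qed

text \<open>Take two times at which the orbit of a core point looks the same on a large window. At both of
  them it is in the same position of a tower over the same letter, so the time difference is the height
  of a word leading from that letter to itself. A coboundary vanishes on such a word, and only the error
  remains of \<open>\<alpha>\<close> times the height.\<close>

lemma return_time_estimate:
  assumes rec: "recognizable A \<tau>" and c: "letter_coboundary (A n) (Y n) c"
    and small: "\<forall>\<^sub>F m in sequentially. \<forall>u\<in>language (Y m).
       int_dist (c (T n m u) - \<alpha> * real (height \<tau> m u)) \<le> e"
    and x0: "x0 \<in> core"
  shows "\<exists>N. \<forall>k l. agree N ((shift ^^ k) x0) ((shift ^^ l) x0) \<longrightarrow>
    int_dist (\<alpha> * real k - \<alpha> * real l) \<le> e"
proof -
  have "\<forall>\<^sub>F m in sequentially. 1 \<le> m \<and> n \<le> m \<and>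
      (\<forall>u\<in>language (Y m). int_dist (c (T n m u) - \<alpha> * real (height \<tau> m u)) \<le> e)"
    by (intro eventually_conj eventually_ge_at_top small)
  then obtain m where m: "1 \<le> m" "n \<le> m"
    "\<And>u. u \<in> language (Y m) \<Longrightarrow> int_dist (c (T n m u) - \<alpha> * real (height \<tau> m u)) \<le> e"
    using eventually_happens'[OF sequentially_bot] by blast
  obtain y where y: "y \<in> Y m" "x0 = subst_point (T 0 m) y" using x0 by (auto simp: core_def)
  obtain N where N: "\<And>y z j k. y \<in> Y m \<Longrightarrow> z \<in> Y m \<Longrightarrow> j < height \<tau> m [y 0] \<Longrightarrow> k < height \<tau> m [z 0] \<Longrightarrow>
    agree N ((shift ^^ j) (subst_point (T 0 m) y)) ((shift ^^ k) (subst_point (T 0 m) z)) \<Longrightarrow>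
    y 0 = z 0 \<and> j = k"
    using window_determines_tower[OF rec m(1)] by blast
  have loop: "int_dist (\<alpha> * real (height \<tau> m (word y p)) - \<alpha> * real (height \<tau> m (word y q))) \<le> e"
    if pq: "p \<le> q" "y (int p) = y (int q)" for p q
  proof -
    define z where "z = (shift ^^ p) y"
    define u where "u = word z (q - p)"
    have z: "z \<in> Y m" unfolding z_def by (rule level_shift_funpow_shift[OF y(1)])
    have "z (int (q - p)) = z 0"
      using pq by (simp add: z_def funpow_shift of_nat_diff)
    then have "c (T n m u) = 0"
      unfolding u_def by (rule coboundary_loop[OF coboundary_pullback[OF c m(2)] z])
    then have "int_dist (- (\<alpha> * real (height \<tau> m u))) \<le> e"
      using m(3)[OF word_in_language[OF z], of "q - p"] by (simp add: u_def)
    moreover have "word y q = word y p @ u"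
      unfolding u_def z_def using word_add[of y p "q - p"] pq(1) by simp
    then have "height \<tau> m (word y q) = height \<tau> m (word y p) + height \<tau> m u"
      unfolding u_def using height_append[OF word_in_lists word_in_lists]
        level_shift_points[OF y(1)] level_shift_points[OF z] by simp
    ultimately show ?thesis by (simp add: algebra_simps)
  qed
  have "int_dist (\<alpha> * real k - \<alpha> * real l) \<le> e"
    if kl: "agree N ((shift ^^ k) x0) ((shift ^^ l) x0)" for k l
  proof -
    obtain p i where p: "i < height \<tau> m [y (int p)]" "k = height \<tau> m (word y p) + i"
      using tower_position[OF y(1)] by blast
    obtain q j where q: "j < height \<tau> m [y (int q)]" "l = height \<tau> m (word y q) + j"
      using tower_position[OF y(1)] by blast
    have S: "(shift ^^ (height \<tau> m (word y p) + i)) x0 =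
        (shift ^^ i) (subst_point (T 0 m) ((shift ^^ p) y))" for p i
      using point_T_funpow_shift[of 0 m, OF _ y(1)]
      by (simp add: y(2) height_def funpow_add add.commute)
    have "((shift ^^ p) y) 0 = ((shift ^^ q) y) 0 \<and> i = j"
      using kl p q unfolding p(2) q(2) S
      by (intro N level_shift_funpow_shift y) (auto simp: funpow_shift)
    then have pq: "y (int p) = y (int q)" "i = j" by (auto simp: funpow_shift)
    have "int_dist (\<alpha> * real (height \<tau> m (word y p)) - \<alpha> * real (height \<tau> m (word y q))) \<le> e"
    proof (cases "p \<le> q")
      case False
      then show ?thesis
        using loop[of q p] pq(1) int_dist_commute[of "\<alpha> * real (height \<tau> m (word y p))"] by simp
    qed (use loop pq in auto)
    then show ?thesis unfolding p(2) q(2) pq(2) by (simp add: algebra_simps)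
  qed
  then show ?thesis by blast
qed

text \<open>On the orbit of a core point the eigenfunction has to be \<open>k \<mapsto> \<alpha> k\<close> modulo one. The preceding
  estimate says that this function is uniformly continuous there, so it extends to the closure.\<close>

lemma eigenvalue_of_coboundary:
  assumes rec: "recognizable A \<tau>" and c: "letter_coboundary (A n) (Y n) c"
    and small: "\<And>e. 0 < e \<Longrightarrow> \<forall>\<^sub>F m in sequentially. \<forall>u\<in>language (Y m).
       int_dist (c (T n m u) - \<alpha> * real (height \<tau> m u)) \<le> e"
  shows "additive_eigenvalue (A 0) (Y 0) \<alpha>"
proof -
  obtain x0 where x0: "x0 \<in> core" using core_nonempty by blast
  have "\<exists>N. \<forall>k l. agree N ((shift ^^ k) x0) ((shift ^^ l) x0) \<longrightarrow>
    int_dist (\<alpha> * real k - \<alpha> * real l) \<le> e" if "0 < e" for e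
    by (rule return_time_estimate[OF rec c small[OF that] x0])
  then obtain W where W: "\<And>e k l. 0 < e \<Longrightarrow> agree (W e) ((shift ^^ k) x0) ((shift ^^ l) x0) \<Longrightarrow>
    int_dist (\<alpha> * real k - \<alpha> * real l) \<le> e" by metis
  have "\<exists>L. \<forall>e>0. \<forall>k. agree (W (e / 2)) x ((shift ^^ k) x0) \<longrightarrow> int_dist (\<alpha> * real k - L) \<le> e"
    if x: "x \<in> Y 0" for x
  proof -
    obtain k where k: "\<And>N. agree N x ((shift ^^ k N) x0)"
      using core_orbit_dense[OF x0 x] by metis
    have "\<exists>N. \<forall>i\<ge>N. \<forall>j\<ge>N. int_dist (\<alpha> * real (k i) - \<alpha> * real (k j)) \<le> e" if "0 < e" for e
    proof -
      have "agree (W e) ((shift ^^ k i) x0) ((shift ^^ k j) x0)" if "W e \<le> i" "W e \<le> j" for i j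
        by (rule agree_trans[OF agree_sym[OF agree_mono[OF k that(1)]] agree_mono[OF k that(2)]])
      then show ?thesis using W[OF that] by blast
    qed
    then obtain L where L: "\<forall>e>0. \<exists>N. \<forall>i\<ge>N. int_dist (\<alpha> * real (k i) - L) \<le> e"
      using Cauchy_mod_1_limit[of "\<lambda>i. \<alpha> * real (k i)"] by blast
    have "int_dist (\<alpha> * real l - L) \<le> e"
      if e: "0 < e" and l: "agree (W (e / 2)) x ((shift ^^ l) x0)" for e l
    proof -
      have e2: "0 < e / 2" using e by simp
      obtain N where N: "\<forall>i\<ge>N. int_dist (\<alpha> * real (k i) - L) \<le> e / 2" using L e2 by blast
      define i where "i = max N (W (e / 2))"
      have "agree (W (e / 2)) x ((shift ^^ k i) x0)"
        by (rule agree_mono[OF k]) (simp add: i_def)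
      then have "int_dist (\<alpha> * real l - \<alpha> * real (k i)) \<le> e / 2"
        by (intro W[OF e2] agree_trans[OF agree_sym[OF l]])
      moreover have "int_dist (\<alpha> * real (k i) - L) \<le> e / 2" using N by (simp add: i_def)
      ultimately show ?thesis
        using int_dist_triangle'[of "\<alpha> * real l" L "\<alpha> * real (k i)"] by linarith
    qed
    then show ?thesis by blast
  qed
  then obtain g where g: "\<And>x e k. x \<in> Y 0 \<Longrightarrow> 0 < e \<Longrightarrow> agree (W (e / 2)) x ((shift ^^ k) x0) \<Longrightarrow>
    int_dist (\<alpha> * real k - g x) \<le> e" by metis
  have "\<exists>N. \<forall>y\<in>Y 0. agree N x y \<longrightarrow> int_dist (g y - g x) < e" if x: "x \<in> Y 0" and e: "0 < e" for x e
  proof -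
    have e3: "0 < e / 3" using e by simp
    have "int_dist (g y - g x) < e" if y: "y \<in> Y 0" and xy: "agree (W (e / 3 / 2)) x y" for y
    proof -
      obtain k where k: "agree (W (e / 3 / 2)) y ((shift ^^ k) x0)"
        using core_orbit_dense[OF x0 y] by blast
      show ?thesis
        using g[OF y e3 k] g[OF x e3 agree_trans[OF xy k]] e
          int_dist_triangle'[of "g y" "g x" "\<alpha> * real k"] int_dist_commute[of "g y" "\<alpha> * real k"]
        by linarith
    qed
    then show ?thesis by blast
  qed
  moreover have "g (shift x) - (g x + \<alpha>) \<in> \<int>" if x: "x \<in> Y 0" for x
  proof (rule Ints_if_int_dist_small)
    fix e :: real assume "0 < e"
    then have e2: "0 < e / 2" by simp
    have Sx: "shift x \<in> Y 0" using level_shift_funpow_shift[OF x, of 1] by simp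
    define N where "N = W (e / 2 / 2)"
    obtain k where k: "agree (Suc N) x ((shift ^^ k) x0)"
      using core_orbit_dense[OF x0 x] by blast
    have "agree N (shift x) ((shift ^^ Suc k) x0)"
      unfolding agree_def
    proof (intro allI impI)
      fix i :: int assume "\<bar>i\<bar> \<le> int N"
      then have "x (i + 1) = (shift ^^ k) x0 (i + 1)" using k by (simp add: agree_def)
      then show "shift x i = (shift ^^ Suc k) x0 i"
        by (simp add: shift_def funpow_shift add.commute add.left_commute)
    qed
    then have "int_dist (\<alpha> * real (Suc k) - g (shift x)) \<le> e / 2"
      unfolding N_def by (rule g[OF Sx e2])
    then have 1: "int_dist (g (shift x) - \<alpha> * real (Suc k)) \<le> e / 2"
      by (simp only: int_dist_commute[of "g (shift x)"])
    have 2: "int_dist (\<alpha> * real k - g x) \<le> e / 2"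
      using agree_mono[OF k] by (intro g[OF x e2]) (simp add: N_def)
    have "g (shift x) - (g x + \<alpha>) =
        (g (shift x) - \<alpha> * real (Suc k)) + (\<alpha> * real k - g x)" by (simp add: algebra_simps)
    then have "int_dist (g (shift x) - (g x + \<alpha>)) \<le>
        int_dist (g (shift x) - \<alpha> * real (Suc k)) + int_dist (\<alpha> * real k - g x)"
      by (simp only: int_dist_triangle)
    also have "\<dots> \<le> e / 2 + e / 2" using 1 2 by (rule add_mono)
    finally show "int_dist (g (shift x) - (g x + \<alpha>)) \<le> e" by simp
  qed
  moreover have "Y 0 \<subseteq> points (A 0)" using level_shift_points by blast
  ultimately show ?thesis by (subst additive_eigenvalue_iff) blast+
qed

end

section \<open>The characterization of eigenvalues\<close>

theorem theorem5p2:
  fixes A :: "nat \<Rightarrow> 'a set"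
    and \<tau> :: "nat \<Rightarrow> 'a list \<Rightarrow> 'a list"
    and X :: "(int \<Rightarrow> 'a) set"
    and \<alpha> :: real
  assumes "directive_sequence A \<tau>"
    and "primitive A \<tau>"
    and "recognizable A \<tau>"
    and "subshift (A 0) X"
    and "generates A \<tau> X"
    and "bdd_above (range (\<lambda>n. card (A n)))"
  shows
    "(additive_eigenvalue (A 0) X \<alpha> \<longleftrightarrow>
       (\<exists>n c. letter_coboundary (A n) (level_shift A \<tau> n) c \<and>
          (\<lambda>m. SUP u \<in> language (level_shift A \<tau> m).
             ereal (int_dist (c (subst_comp \<tau> n m u) - \<alpha> * real (height \<tau> m u)))) \<longlonglongrightarrow> 0)) \<and>
     (additive_eigenvalue (A 0) X \<alpha> \<longleftrightarrow>
       (\<exists>n c. letter_coboundary (A n) (level_shift A \<tau> n) c \<and>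
          (let \<gamma> = \<lambda>w. \<Sum>a\<leftarrow>w. centered_frac (c [a] - \<alpha> * real (height \<tau> n [a])) in
            (\<lambda>m. SUP u \<in> language (level_shift A \<tau> m).
               ereal \<bar>\<gamma> (subst_comp \<tau> n m u)\<bar>) \<longlonglongrightarrow> 0)))"
proof -
  interpret primitive_directive_sequence A \<tau>
    using assms(1,2) by unfold_locales
  have X: "X = Y 0" using assms(5) by (simp add: generates_def)
  have "Y 0 \<subseteq> points (A 0)" using level_shift_points by blast
  note eigenvalue_iff = additive_eigenvalue_iff[OF this]
  have L: "language (Y m) \<noteq> {}" for m
    using level_shift_nonempty[of m] word_in_language by blast
  define P where "P = (\<lambda>n c. \<forall>e>0. \<forall>\<^sub>F m in sequentially. \<forall>u\<in>language (Y m).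
    int_dist (c (T n m u) - \<alpha> * real (height \<tau> m u)) \<le> e)"
  define Q where "Q = (\<lambda>n c. \<forall>e>0. \<forall>\<^sub>F m in sequentially. \<forall>u\<in>language (Y m).
    \<bar>lifted_error \<alpha> n c (T n m u)\<bar> \<le> e)"
  have P: "(\<lambda>m. SUP u \<in> language (Y m). ereal (int_dist (c (T n m u) - \<alpha> * real (height \<tau> m u)))) \<longlonglongrightarrow> 0
      \<longleftrightarrow> P n c" for n c
    unfolding P_def by (rule SUP_tendsto_0_iff[OF _ L]) simp
  have Q: "(\<lambda>m. SUP u \<in> language (Y m). ereal \<bar>lifted_error \<alpha> n c (T n m u)\<bar>) \<longlonglongrightarrow> 0 \<longleftrightarrow> Q n c" for n c
    unfolding Q_def by (rule SUP_tendsto_0_iff[OF _ L]) simp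
  have "\<exists>n c. letter_coboundary (A n) (Y n) c \<and> P n c" if ev: "additive_eigenvalue (A 0) (Y 0) \<alpha>"
  proof -
    obtain g where g: "\<forall>x\<in>Y 0. \<forall>e>0. \<exists>N. \<forall>y\<in>Y 0. agree N x y \<longrightarrow> int_dist (g y - g x) < e"
      "\<forall>x\<in>Y 0. g (shift x) - (g x + \<alpha>) \<in> \<int>"
      using ev unfolding eigenvalue_iff by blast
    interpret eigenfunction A \<tau> g \<alpha>
      using g by unfold_locales blast+
    show ?thesis unfolding P_def by (rule coboundary_of_eigenfunction[OF assms(6)])
  qed
  moreover have "additive_eigenvalue (A 0) (Y 0) \<alpha>" if "letter_coboundary (A n) (Y n) c" "P n c" for n c
    using eigenvalue_of_coboundary[OF assms(3) that(1)] that(2) unfolding P_def by blast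
  moreover have "\<exists>n c. letter_coboundary (A n) (Y n) c \<and> Q n c"
    if "letter_coboundary (A n) (Y n) c" "P n c" for n c
    using real_error_of_mod_1_error[OF that(1)] that(2) unfolding P_def Q_def by blast
  moreover have "P n c" if "letter_coboundary (A n) (Y n) c" "Q n c" for n c
    using mod_1_error_of_real_error[OF that(1)] that(2) unfolding P_def Q_def by blast
  ultimately show ?thesis
    unfolding X Let_def lifted_error_def[symmetric] P Q by blast
qed

end
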